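(* Let $\mathcal{A}\in\mathbb{C}^{m\times\ell\times n}$ be such that $\mathcal{A}_{i::}\mathcal{A}_{i::}^*\in\mathbb{C}^{1\times1\times n}$ is invertible (under the t-product) for every $i\in\{0,\dots,m-1\}$. Let $\mathcal{B}\in\mathbb{C}^{m\times p\times n}$ and let $\mathcal{X}^*\in\mathbb{C}^{\ell\times p\times n}$ satisfy $\mathcal{A}\mathcal{X}^*=\mathcal{B}$. Let $i_0,i_1,i_2,\dots$ be sampled independently and uniformly at random from $\{0,\dots,m-1\}$, let $\mathcal{X}^0\in\mathbb{C}^{\ell\times p\times n}$ be an initial iterate, and define for $t\ge0$ $$\mathcal{X}^{t+1}=\mathcal{X}^t-\mathcal{A}_{i_t::}^*\left(\mathcal{A}_{i_t::}\mathcal{A}_{i_t::}^*\right)^{-1}\left(\mathcal{A}_{i_t::}\mathcal{X}^t-\mathcal{B}_{i_t::}\right).$$ Then for every $t\ge0$ $$\mathbb{E}\left[\|\mathcal{X}^{t+1}-\mathcal{X}^*\|_F^2\,\middle|\,\mathcal{X}^0\right]\le\left(1-\min_{0\le k\le n-1}\frac{\sigma_{\min}^2(\widehat{\mathcal{A}}_k)}{m\,\|\widehat{\mathcal{A}}_k\|_{\infty,2}^2}\right)^{t+1}\|\mathcal{X}^0-\mathcal{X}^*\|_F^2,$$ where $\widehat{\mathcal{A}}_k\in\mathbb{C}^{m\times\ell}$ is the $k$-th frontal slice of the mode-3 Fourier transform $\widehat{\mathcal{A}}$ of $\mathcal{A}$. (Here $\mathcal{X}^*$ is the name of the solution, not a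 transpose.)
   Context: Indices start at 0. For a third-order tensor $\mathcal{M}\in\mathbb{C}^{m\times\ell\times n}$: $\mathbf{M}_k=\mathcal{M}_{::k}\in\mathbb{C}^{m\times\ell}$ ($0\le k\le n-1$) is its $k$-th frontal slice; $\mathcal{M}_{i::}\in\mathbb{C}^{1\times\ell\times n}$ is its $i$-th row slice; $\|\mathcal{M}\|_F^2$ is the sum of the squared moduli of all entries. $\mathrm{unfold}(\mathcal{M})\in\mathbb{C}^{mn\times\ell}$ is the matrix obtained by stacking $\mathbf{M}_0,\dots,\mathbf{M}_{n-1}$ vertically, and $\mathrm{fold}$ is its inverse. $\mathrm{bcirc}(\mathcal{M})\in\mathbb{C}^{mn\times\ell n}$ is the block-circulant matrix whose $(r,s)$ block ($0\le r,s\le n-1$) is $\mathbf{M}_{(r-s)\bmod n}$. The t-product of $\mathcal{A}\in\mathbb{C}^{m\times\ell\times n}$ and $\mathcal{B}\in\mathbb{C}^{\ell\times p\times n}$ is $\mathcal{A}\mathcal{B}=\mathrm{fold}(\mathrm{bcirc}(\mathcal{A})\,\mathrm{unfold}(\mathcal{B}))\in\mathbb{C}^{m\times p\times n}$; all tensor products are t-products. The identity tensor $\mathcal{I}\in\mathbb{C}^{m\times m\times n}$ has first frontal slice $\mathbf{I}_m$ and all other entries zero. A tensor $\mathcal{M}$ is invertible if there is $\mathcal{M}^{-1}$ with $\mathcal{M}\mathcal{M}^{-1}=\mathcal{M}^{-1}\mathcal{M}=\mathcal{I}$. The conjugate transpose $\mathcal{M}^*\in\mathbb{C}^{\ell\times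 m\times n}$ has $(\mathcal{M}^* )_{::0}=\mathbf{M}_0^*$ and $(\mathcal{M}^* )_{::k}=\mathbf{M}_{n-k}^*$ for $1\le k\le n-1$. We write $\mathcal{A}_{i::}^*=(\mathcal{A}_{i::})^*$. Let $\mathbf{F}_n$ be the unitary $n\times n$ DFT matrix, $(\mathbf{F}_n)_{jk}=\frac{1}{\sqrt n}e^{-2\pi \mathrm{i} jk/n}$. The mode-3 Fourier transform $\widehat{\mathcal{M}}$ of $\mathcal{M}\in\mathbb{C}^{m\times\ell\times n}$ is the tensor whose frontal slices $\widehat{\mathcal{M}}_0,\dots,\widehat{\mathcal{M}}_{n-1}$ are the diagonal blocks of the block-diagonal matrix $(\mathbf{F}_n\otimes\mathbf{I}_m)\,\mathrm{bcirc}(\mathcal{M})\,(\mathbf{F}_n^*\otimes\mathbf{I}_\ell)$; equivalently $\widehat{\mathcal{M}}_k=\sum_{j=0}^{n-1}e^{-2\pi\mathrm{i}jk/n}\mathbf{M}_j$. Further, $\|\widehat{\mathcal{A}}_k\|_{\infty,2}^2=\max_{0\le i\le m-1}(\widehat{\mathcal{A}}_k)_{i:}\,(\widehat{\mathcal{A}}_k)_{i:}^*$, the maximum squared Euclidean norm of a row of $\widehat{\mathcal{A}}_k$. For a matrix $\mathbf{M}$, $\sigma_{\min}(\mathbf{M})$ is the smallest singular value, in the sense $\sigma_{\min}^2(\mathbf{M})=\lambda_{\min}(\mathbf{M}^*\mathbf{M})$ (so it is $0$ if $\mathbf{M}$ has fewer rows than columns). *)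

theory Defs
  imports "HOL-Probability.Probability" "Jordan_Normal_Form.Schur_Decomposition"
begin

text \<open>A third-order tensor is the list of its frontal slices; all slices have the same dimensions,
  and entry \<open>(i, j, k)\<close> is \<open>M ! k $$ (i, j)\<close>.\<close>

type_synonym tensor = "complex mat list"

definition tensors :: "nat \<Rightarrow> nat \<Rightarrow> nat \<Rightarrow> tensor set" where
  "tensors m l n = {M. length M = n \<and> set M \<subseteq> carrier_mat m l}"

text \<open>The dimensions are read off slice 0, so they are meaningful for depth at least 1 only.\<close>

definition trows :: "tensor \<Rightarrow> nat" where
  "trows M = dim_row (M ! 0)"

definition tcols :: "tensor \<Rightarrow> nat" where
  "tcols M = dim_col (M ! 0)"

definition row_slice :: "tensor \<Rightarrow> nat \<Rightarrow> tensor" where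
  "row_slice M i = map (\<lambda>S. mat 1 (dim_col S) (\<lambda>(_, j). S $$ (i, j))) M"

definition tminus :: "tensor \<Rightarrow> tensor \<Rightarrow> tensor"  (infixl \<open>\<ominus>\<^sub>t\<close> 65) where
  "A \<ominus>\<^sub>t B = map2 (-) A B"

definition frob_norm :: "tensor \<Rightarrow> real" where
  "frob_norm M = sqrt (\<Sum>k<length M. \<Sum>i<dim_row (M ! k). \<Sum>j<dim_col (M ! k). (cmod (M ! k $$ (i, j)))\<^sup>2)"

text \<open>The operations \<open>unfold\<close>, \<open>fold\<close> and \<open>bcirc\<close>; row \<open>r\<close> of a stacked matrix is row \<open>r mod m\<close>
  of block \<open>r div m\<close>. Adding \<open>n\<close> keeps the truncated subtraction of block indices exact.\<close>

definition tunfold :: "tensor \<Rightarrow> complex mat" where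
  "tunfold M = (let m = trows M in
     mat (m * length M) (tcols M) (\<lambda>(r, j). M ! (r div m) $$ (r mod m, j)))"

definition tfold :: "nat \<Rightarrow> complex mat \<Rightarrow> tensor" where
  "tfold n N = (let m = dim_row N div n in
     map (\<lambda>k. mat m (dim_col N) (\<lambda>(i, j). N $$ (k * m + i, j))) [0..<n])"

definition bcirc :: "tensor \<Rightarrow> complex mat" where
  "bcirc M = (let m = trows M; l = tcols M; n = length M in
     mat (m * n) (l * n)
       (\<lambda>(r, c). M ! ((r div m + n - c div l) mod n) $$ (r mod m, c mod l)))"

definition tprod :: "tensor \<Rightarrow> tensor \<Rightarrow> tensor"  (infixl \<open>\<star>\<^sub>t\<close> 70) where
  "A \<star>\<^sub>t B = tfold (length A) (bcirc A * tunfold B)"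

definition tid :: "nat \<Rightarrow> nat \<Rightarrow> tensor" where
  "tid m n = map (\<lambda>k. if k = 0 then 1\<^sub>m m else 0\<^sub>m m m) [0..<n]"

definition tinverts :: "tensor \<Rightarrow> tensor \<Rightarrow> bool" where
  "tinverts M N \<longleftrightarrow> (let m = trows M; n = length M in
     M \<in> tensors m m n \<and> N \<in> tensors m m n \<and> M \<star>\<^sub>t N = tid m n \<and> N \<star>\<^sub>t M = tid m n)"

definition tinvertible :: "tensor \<Rightarrow> bool" where
  "tinvertible M \<longleftrightarrow> (\<exists>N. tinverts M N)"

definition tinv :: "tensor \<Rightarrow> tensor" where
  "tinv M = (THE N. tinverts M N)"

definition tadjoint :: "tensor \<Rightarrow> tensor" where
  "tadjoint M =
     map (\<lambda>k. mat_adjoint (M ! (if k = 0 then 0 else length M - k))) [0..<length M]"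

definition kronecker :: "complex mat \<Rightarrow> complex mat \<Rightarrow> complex mat" where
  "kronecker A B = mat (dim_row A * dim_row B) (dim_col A * dim_col B)
     (\<lambda>(r, c). A $$ (r div dim_row B, c div dim_col B) * B $$ (r mod dim_row B, c mod dim_col B))"

definition dft :: "nat \<Rightarrow> complex mat" where
  "dft n = mat n n (\<lambda>(j, k). complex_of_real (1 / sqrt (real n)) *
     exp (- (2 * complex_of_real pi * \<i> * of_nat j * of_nat k / of_nat n)))"

text \<open>The mode-3 Fourier transform: its frontal slices are the diagonal blocks of the
  block-diagonalised block-circulant matrix.\<close>

definition fourier3 :: "tensor \<Rightarrow> tensor" where
  "fourier3 M = (let m = trows M; l = tcols M; n = length M;
       D = kronecker (dft n) (1\<^sub>m m) * bcirc M * kronecker (mat_adjoint (dft n)) (1\<^sub>m l) in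
     map (\<lambda>k. mat m l (\<lambda>(i, j). D $$ (k * m + i, k * l + j))) [0..<n])"

definition norm_inf_2 :: "complex mat \<Rightarrow> real" where
  "norm_inf_2 M = Max ((\<lambda>i. sqrt (\<Sum>j<dim_col M. (cmod (M $$ (i, j)))\<^sup>2)) ` {..<dim_row M})"

text \<open>Only applied to Hermitian matrices, where every eigenvalue is real.\<close>

definition lambda_min :: "complex mat \<Rightarrow> real" where
  "lambda_min H = Min {x. eigenvalue H (complex_of_real x)}"

definition sigma_min :: "complex mat \<Rightarrow> real" where
  "sigma_min M = sqrt (lambda_min (mat_adjoint M * M))"

text \<open>The iterate after \<open>t\<close> steps, started at \<open>X\<^sub>0\<close> and using the row indices \<open>i 0, i 1, \<dots>\<close>.\<close>

primrec kaczmarz :: "tensor \<Rightarrow> tensor \<Rightarrow> tensor \<Rightarrow> (nat \<Rightarrow> nat) \<Rightarrow> nat \<Rightarrow> tensor" where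
  "kaczmarz A B X0 i 0 = X0"
| "kaczmarz A B X0 i (Suc t) =
     (let X = kaczmarz A B X0 i t; a = row_slice A (i t) in
      X \<ominus>\<^sub>t tadjoint a \<star>\<^sub>t tinv (a \<star>\<^sub>t tadjoint a) \<star>\<^sub>t (a \<star>\<^sub>t X \<ominus>\<^sub>t row_slice B (i t)))"

text \<open>The Borel sigma-algebra on tensors of fixed dimensions, generated by the entry maps.\<close>

definition tensor_borel :: "nat \<Rightarrow> nat \<Rightarrow> nat \<Rightarrow> tensor measure" where
  "tensor_borel m l n = vimage_algebra (tensors m l n)
     (\<lambda>M. restrict (\<lambda>(i, j, k). M ! k $$ (i, j)) ({..<m} \<times> {..<l} \<times> {..<n}))
     (PiM ({..<m} \<times> {..<l} \<times> {..<n}) (\<lambda>_. borel))"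

definition sigma_gen :: "'w measure \<Rightarrow> ('w \<Rightarrow> 'b) \<Rightarrow> 'b measure \<Rightarrow> 'w measure" where
  "sigma_gen P X N = vimage_algebra (space P) X N"

end

theory Submission
  imports Defs
begin

text \<open>The Fourier transform along the third mode turns t-products into slicewise matrix products
  and is, up to the factor \<open>n\<close>, an isometry. In the \<open>k\<close>-th Fourier slice a Kaczmarz step therefore
  projects each column of the error orthogonally to the conjugate of row \<open>i\<^sub>t\<close> of the \<open>k\<close>-th slice of the
  transform of \<open>A\<close>. Averaging the removed energy over the \<open>m\<close> rows and
  bounding it below by \<open>\<sigma>\<^sub>m\<^sub>i\<^sub>n\<^sup>2\<close> divided by \<open>m\<close> times the maximal squared row norm gives the contraction
  factor of one step. Summing over all \<open>m\<^sup>t\<^sup>+\<^sup>1\<close> index paths, each of which is independent of \<open>X\<^sub>0\<close> and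
  has probability \<open>1 / m\<^sup>t\<^sup>+\<^sup>1\<close>, computes the conditional expectation.\<close>

section \<open>The smallest singular value as a Rayleigh minimum\<close>

text \<open>One draw acts on all Fourier slices at once, and the Frobenius norm adds their energies.
  Each slice has its own contraction factor, so only the worst one serves for the sum: this is the
  minimum over \<open>k\<close>. Uniform sampling causes a second loss. A row of norm
  \<open>r\<close> removes the energy \<open>|S|^2 / r^2\<close>; replacing every \<open>r\<close>
  by the largest row norm turns the sum over the rows into the squared norm of the slice applied to
  the error, which the smallest singular value controls. For that control one eigenvalue of the Gram
  matrix that bounds its Rayleigh quotient from below is enough; a minimiser over the unit sphere
  supplies it, with no diagonalisation. There is no step-by-step conditioning and no filtration. The
  contraction over \<open>t + 1\<close> steps is a deterministic inequality between sums over index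
  paths. Probability enters once, to turn the conditional expectation into such a sum, and the
  factors \<open>m\<close> gained by summing instead of averaging cancel against the path
  probabilities.\<close>

lemma compact_unit_sphere_coords:
  "compact {x :: nat \<Rightarrow> complex. (\<forall>c\<ge>l. x c = 0) \<and> (\<Sum>c<l. (cmod (x c))\<^sup>2) = 1}" (is "compact ?S")
proof -
  let ?T = "\<lambda>c. if c < l then cball (0::complex) 1 else {0}"
  \<comment> \<open>Vectors of length \<open>l\<close> are encoded as functions vanishing from
    \<open>l\<close> on, so Tychonoff applies to a product of unit discs and singletons; the sphere
    is a closed part of it.\<close>
  have "compactin (product_topology (\<lambda>_. euclidean) UNIV) (PiE UNIV ?T)"
    by (subst compactin_PiE) auto
  then have "compact (PiE UNIV ?T)"
    by (simp add: euclidean_product_topology)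
  moreover have "closed {x :: nat \<Rightarrow> complex. (\<Sum>c<l. (cmod (x c))\<^sup>2) = 1}"
    by (intro closed_Collect_eq continuous_intros continuous_on_product_coordinates)
  ultimately have "compact (PiE UNIV ?T \<inter> {x. (\<Sum>c<l. (cmod (x c))\<^sup>2) = 1})"
    by blast
  also have "PiE UNIV ?T \<inter> {x. (\<Sum>c<l. (cmod (x c))\<^sup>2) = 1} = ?S"
  proof (intro Set.set_eqI iffI)
    fix x assume "x \<in> PiE UNIV ?T \<inter> {x. (\<Sum>c<l. (cmod (x c))\<^sup>2) = 1}"
    then have "x \<in> PiE UNIV ?T" and "(\<Sum>c<l. (cmod (x c))\<^sup>2) = 1" by blast+
    moreover have "x c = 0" if "l \<le> c" for c
      using PiE_mem[OF \<open>x \<in> PiE UNIV ?T\<close>, of c] that by simp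
    ultimately show "x \<in> ?S" by blast
  next
    fix x assume x: "x \<in> ?S"
    have "cmod (x c) \<le> 1" if "c < l" for c
    proof -
      have "(cmod (x c))\<^sup>2 \<le> (\<Sum>c<l. (cmod (x c))\<^sup>2)"
        using that by (intro member_le_sum) auto
      then show ?thesis using x by (simp add: power_le_one_iff)
    qed
    then show "x \<in> PiE UNIV ?T \<inter> {x. (\<Sum>c<l. (cmod (x c))\<^sup>2) = 1}"
      using x by (auto simp: PiE_iff)
  qed
  finally show ?thesis .
qed

lemma cmod_diff_square: "(cmod (u - v))\<^sup>2 = (cmod u)\<^sup>2 + (cmod v)\<^sup>2 - 2 * Re (cnj v * u)"
  unfolding cmod_power2 by (simp add: power2_eq_square algebra_simps)

text \<open>\<open>x\<close> minimises the squared norm of the image on the unit sphere, which is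
  nonempty by \<open>0 < l\<close>, and \<open>\<mu>\<close> is the minimum. The inequality extends
  to all \<open>y\<close> by homogeneity; the eigenvalue equation holds because the first variation
  vanishes at a minimiser.\<close>

lemma rayleigh_minimiser:
  fixes a :: "nat \<Rightarrow> nat \<Rightarrow> complex"
  assumes "0 < l"
  obtains x \<mu> where "\<exists>c<l. x c \<noteq> 0"
    "\<And>c. c < l \<Longrightarrow> (\<Sum>r<m. cnj (a r c) * (\<Sum>d<l. a r d * x d)) = complex_of_real \<mu> * x c"
    "\<And>y. \<mu> * (\<Sum>c<l. (cmod (y c))\<^sup>2) \<le> (\<Sum>r<m. (cmod (\<Sum>c<l. a r c * y c))\<^sup>2)"
proof -
  define q where "q y = (\<Sum>r<m. (cmod (\<Sum>c<l. a r c * y c))\<^sup>2)" for y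
  define s where "s y = (\<Sum>c<l. (cmod (y c))\<^sup>2)" for y :: "nat \<Rightarrow> complex"
  let ?S = "{x :: nat \<Rightarrow> complex. (\<forall>c\<ge>l. x c = 0) \<and> s x = 1}"
  have "compact ?S" unfolding s_def by (rule compact_unit_sphere_coords)
  moreover have "s (\<lambda>c. if c = 0 then 1 else 0) = (\<Sum>c<l. if c = 0 then 1 else 0)"
    unfolding s_def by (intro sum.cong) auto
  then have "s (\<lambda>c. if c = 0 then 1 else 0) = 1" using assms by simp
  then have "?S \<noteq> {}" using assms by (auto intro!: exI[of _ "\<lambda>c. if c = 0 then 1 else 0"])
  moreover have "continuous_on ?S q" unfolding q_def
    by (intro continuous_intros continuous_on_subset[OF continuous_on_product_coordinates]) auto
  ultimately obtain x where x: "x \<in> ?S" and min: "\<And>y. y \<in> ?S \<Longrightarrow> q x \<le> q y"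
    using continuous_attains_inf[of ?S q] by blast
  have ray: "q x * s y \<le> q y" for y
  proof (cases "s y = 0")
    case True
    have "0 \<le> q y" unfolding q_def by (intro sum_nonneg) auto
    with True show ?thesis by simp
  next
    case False
    have "0 \<le> s y" unfolding s_def by (intro sum_nonneg) auto
    with False have pos: "0 < s y" by simp
    \<comment> \<open>Normalising and cutting off from \<open>l\<close> on puts \<open>z\<close> on
      the sphere; \<open>s\<close> and \<open>q\<close> do not see the coordinates that are
      cut.\<close>
    define z where "z c = (if c < l then y c / complex_of_real (sqrt (s y)) else 0)" for c
    have "s z = (\<Sum>c<l. (cmod (y c))\<^sup>2 / s y)"
      unfolding s_def[of z] z_def using pos
      by (intro sum.cong) (auto simp: norm_divide power_divide)
    then have "s z = 1" using pos by (simp add: s_def sum_divide_distrib[symmetric])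
    then have "q x \<le> q z" by (intro min) (auto simp: z_def)
    also have "q z = (\<Sum>r<m. (cmod (\<Sum>c<l. a r c * y c))\<^sup>2 / s y)"
    proof -
      have "(\<Sum>c<l. a r c * z c) = (\<Sum>c<l. a r c * y c) / complex_of_real (sqrt (s y))" for r
        unfolding sum_divide_distrib by (intro sum.cong) (auto simp: z_def)
      then show ?thesis using pos by (simp add: q_def norm_divide power_divide)
    qed
    also have "\<dots> = q y / s y" by (simp add: q_def sum_divide_distrib)
    finally show ?thesis using pos by (simp add: field_simps)
  qed
  define \<mu> where "\<mu> = q x"
  define L where "L r y = (\<Sum>c<l. a r c * y c)" for r y
  define g where "g c = (\<Sum>r<m. cnj (a r c) * L r x) - complex_of_real \<mu> * x c" for c
  define G where "G = s g"
  \<comment> \<open>The nonnegative form \<open>q - \<mu> s\<close> vanishes at \<open>x\<close>; moving along its gradient \<open>g\<close> by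
    \<open>\<epsilon>\<close> changes it by \<open>- 2 \<epsilon> |g|\<^sup>2 + O(\<epsilon>\<^sup>2)\<close>, so \<open>g = 0\<close>.\<close>
  have pert: "2 * G \<le> \<epsilon> * (q g - \<mu> * s g)" if "0 < \<epsilon>" for \<epsilon> :: real
  proof -
    define y where "y c = x c - complex_of_real \<epsilon> * g c" for c
    have Ly: "L r y = L r x - complex_of_real \<epsilon> * L r g" for r
      by (simp add: L_def y_def algebra_simps sum_subtractf sum_distrib_left)
    have qy: "q y = q x + \<epsilon>\<^sup>2 * q g - 2 * \<epsilon> * Re (\<Sum>r<m. cnj (L r g) * L r x)"
      unfolding q_def L_def[symmetric] Ly cmod_diff_square
      by (simp add: sum.distrib sum_subtractf sum_distrib_left norm_mult power_mult_distrib mult.assoc ring_distribs)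
    have sy: "s y = s x + \<epsilon>\<^sup>2 * s g - 2 * \<epsilon> * Re (\<Sum>c<l. cnj (g c) * x c)"
      unfolding s_def y_def cmod_diff_square
      by (simp add: sum.distrib sum_subtractf sum_distrib_left norm_mult power_mult_distrib mult.assoc ring_distribs)
    \<comment> \<open>Moving the map to the other side of the inner product pairs \<open>g\<close>
      with the Gram image of \<open>x\<close>, which is \<open>g + \<mu> x\<close> by the choice of
      \<open>g\<close>. The \<open>\<mu>\<close> part cancels against the same term in
      \<open>sy\<close>.\<close>
    have "(\<Sum>r<m. cnj (L r g) * L r x) = (\<Sum>r<m. \<Sum>c<l. cnj (g c) * (cnj (a r c) * L r x))"
      by (simp add: L_def[of _ g] sum_distrib_left sum_distrib_right mult_ac)
    also have "\<dots> = (\<Sum>c<l. \<Sum>r<m. cnj (g c) * (cnj (a r c) * L r x))"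
      by (rule sum.swap)
    also have "\<dots> = (\<Sum>c<l. cnj (g c) * (g c + complex_of_real \<mu> * x c))"
      by (simp add: g_def sum_distrib_left)
    also have "\<dots> = complex_of_real G + complex_of_real \<mu> * (\<Sum>c<l. cnj (g c) * x c)"
      by (simp add: G_def s_def algebra_simps sum.distrib sum_distrib_left complex_norm_square
          del: of_real_power)
    finally have cross: "Re (\<Sum>r<m. cnj (L r g) * L r x) = G + \<mu> * Re (\<Sum>c<l. cnj (g c) * x c)"
      by simp
    have sx: "s x = 1" using x by simp
    have "\<mu> * s y \<le> q y" using ray[of y] by (simp add: \<mu>_def)
    then have "2 * \<epsilon> * G \<le> \<epsilon>\<^sup>2 * (q g - \<mu> * s g)"
      unfolding qy sy cross sx by (simp add: \<mu>_def algebra_simps)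
    then have "\<epsilon> * (2 * G) \<le> \<epsilon> * (\<epsilon> * (q g - \<mu> * s g))"
      by (simp add: power2_eq_square mult_ac)
    then show ?thesis using that by simp
  qed
  have "0 \<le> G" unfolding G_def s_def by (intro sum_nonneg) auto
  moreover have "G \<le> 0"
  proof (rule ccontr)
    assume "\<not> G \<le> 0"
    then have "0 < G" by simp
    \<comment> \<open>\<open>D\<close> exceeds the second-order coefficient in absolute value, so
      the step size \<open>G / D\<close> leads to \<open>2 * G \<le> G\<close>.\<close>
    define D where "D = \<bar>q g - \<mu> * s g\<bar> + 1"
    have "2 * G \<le> (G / D) * (q g - \<mu> * s g)"
      using \<open>0 < G\<close> by (intro pert) (auto simp: D_def)
    also have "\<dots> \<le> (G / D) * D"
      using \<open>0 < G\<close> by (intro mult_left_mono) (auto simp: D_def)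
    finally show False using \<open>0 < G\<close> by (simp add: D_def)
  qed
  ultimately have "G = 0" by simp
  then have g0: "g c = 0" if "c < l" for c
    using that by (simp add: G_def s_def sum_nonneg_eq_0_iff)
  have "\<exists>c<l. x c \<noteq> 0"
  proof (rule ccontr)
    assume "\<not> (\<exists>c<l. x c \<noteq> 0)"
    then have "s x = 0" by (simp add: s_def)
    then show False using x by simp
  qed
  then show thesis
    using that[of x \<mu>] g0 ray by (simp add: g_def L_def \<mu>_def q_def s_def)
qed

section \<open>Gram matrices and their real eigenvalues\<close>

lemma mat_adjoint_dims [simp]:
  "dim_row (mat_adjoint M) = dim_col M" "dim_col (mat_adjoint M) = dim_row M"
  by (simp_all add: mat_adjoint_def)

lemma mat_adjoint_index [simp]:
  fixes M :: "complex mat"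
  assumes "c < dim_col M" "r < dim_row M"
  shows "mat_adjoint M $$ (c, r) = cnj (M $$ (r, c))"
  using assms by (simp add: mat_adjoint_def mat_of_rows_index)

lemma gram_mult_vec_index:
  fixes M :: "complex mat"
  assumes "M \<in> carrier_mat m l" "v \<in> carrier_vec l" "c < l"
  shows "((mat_adjoint M * M) *\<^sub>v v) $ c =
    (\<Sum>r<m. cnj (M $$ (r, c)) * (\<Sum>d<l. M $$ (r, d) * v $ d))"
proof -
  have "mat_adjoint M \<in> carrier_mat l m" using assms by auto
  then have "(mat_adjoint M * M) *\<^sub>v v = mat_adjoint M *\<^sub>v (M *\<^sub>v v)"
    using assms by (intro assoc_mult_mat_vec) auto
  then show ?thesis
    using assms by (auto simp: scalar_prod_def atLeast0LessThan intro!: sum.cong)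
qed

text \<open>Eigenvalues are roots of the monic, hence nonzero, characteristic polynomial. Finiteness
  lets the \<open>Min\<close> in \<open>lambda_min\<close> be attained.\<close>

lemma finite_real_eigenvalues:
  assumes "(H :: complex mat) \<in> carrier_mat l l"
  shows "finite {x. eigenvalue H (complex_of_real x)}"
proof -
  have "finite {z. eigenvalue H z}"
    using assms degree_monic_char_poly[OF assms]
    by (auto simp: eigenvalue_root_char_poly[OF assms] intro!: poly_roots_finite)
  then have "finite (complex_of_real -` {z. eigenvalue H z})"
    by (intro finite_vimageI) (auto simp: inj_on_def)
  then show ?thesis by (simp add: vimage_def)
qed

text \<open>Pairing the eigenvector equation with \<open>v\<close> gives
  \<open>|M v|^2 = x |v|^2\<close>. Squaring then undoes the square root in
  \<open>sigma_min\<close>.\<close>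

lemma gram_eigenvalue_nonneg:
  fixes M :: "complex mat"
  assumes M: "M \<in> carrier_mat m l" and "eigenvalue (mat_adjoint M * M) (complex_of_real x)"
  shows "0 \<le> x"
proof -
  obtain v where v: "v \<in> carrier_vec l" "v \<noteq> 0\<^sub>v l"
    "(mat_adjoint M * M) *\<^sub>v v = complex_of_real x \<cdot>\<^sub>v v"
    using assms by (auto simp: eigenvalue_def eigenvector_def)
  define s where "s = (\<Sum>c<l. (cmod (v $ c))\<^sup>2)"
  define q where "q = (\<Sum>r<m. (cmod (\<Sum>d<l. M $$ (r, d) * v $ d))\<^sup>2)"
  have "complex_of_real q = (\<Sum>r<m. \<Sum>c<l. cnj (v $ c) * (cnj (M $$ (r, c)) * (\<Sum>d<l. M $$ (r, d) * v $ d)))"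
    unfolding q_def of_real_sum complex_norm_square
    by (simp add: sum_distrib_left sum_distrib_right mult_ac del: of_real_power)
  also have "\<dots> = (\<Sum>c<l. cnj (v $ c) * ((mat_adjoint M * M) *\<^sub>v v) $ c)"
    by (subst sum.swap) (simp add: gram_mult_vec_index[OF M v(1)] sum_distrib_left)
  also have "\<dots> = complex_of_real (x * s)"
    using v(1) unfolding v(3) s_def
    by (simp add: sum_distrib_left complex_norm_square mult_ac del: of_real_power)
  finally have "q = x * s" by (simp only: of_real_eq_iff)
  moreover have "0 \<le> q" unfolding q_def by (intro sum_nonneg) auto
  moreover have "0 < s"
  proof -
    obtain c where "c < l" "v $ c \<noteq> 0" using v(1,2) by (auto simp: vec_eq_iff)
    then show ?thesis unfolding s_def by (intro sum_pos2[of _ c]) auto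
  qed
  ultimately show ?thesis by (simp add: zero_le_mult_iff)
qed

lemma sigma_min_bound:
  assumes M: "M \<in> carrier_mat m l" and "0 < l"
  shows "(sigma_min M)\<^sup>2 * (\<Sum>c<l. (cmod (y c))\<^sup>2) \<le> (\<Sum>r<m. (cmod (\<Sum>c<l. M $$ (r, c) * y c))\<^sup>2)"
proof -
  let ?H = "mat_adjoint M * M"
  let ?E = "{x. eigenvalue ?H (complex_of_real x)}"
  obtain x \<mu> where x: "\<exists>c<l. x c \<noteq> 0"
    "\<And>c. c < l \<Longrightarrow> (\<Sum>r<m. cnj (M $$ (r, c)) * (\<Sum>d<l. M $$ (r, d) * x d)) = complex_of_real \<mu> * x c"
    and \<mu>: "\<And>y. \<mu> * (\<Sum>c<l. (cmod (y c))\<^sup>2) \<le> (\<Sum>r<m. (cmod (\<Sum>c<l. M $$ (r, c) * y c))\<^sup>2)"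
    using rayleigh_minimiser[OF \<open>0 < l\<close>, where m = m and a = "\<lambda>r c. M $$ (r, c)"] by blast
  have "?H *\<^sub>v Matrix.vec l x = complex_of_real \<mu> \<cdot>\<^sub>v Matrix.vec l x"
    using M x(2) by (intro eq_vecI) (auto simp: gram_mult_vec_index[OF M] simp del: index_mult_mat_vec)
  then have "eigenvector ?H (Matrix.vec l x) (complex_of_real \<mu>)"
    using M x(1) by (auto simp: eigenvector_def vec_eq_iff)
  then have "\<mu> \<in> ?E" by (auto simp: eigenvalue_def)
  moreover have "finite ?E" using M by (intro finite_real_eigenvalues[of _ l]) auto
  \<comment> \<open>\<open>\<mu>\<close> belongs to the set whose minimum is
    \<open>lambda_min\<close>; only this inequality is used, not equality of the two.\<close>
  ultimately have "lambda_min ?H \<in> ?E" "lambda_min ?H \<le> \<mu>"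
    unfolding lambda_min_def using Min_in[of ?E] Min_le[of ?E \<mu>] by blast+
  then have "(sigma_min M)\<^sup>2 \<le> \<mu>"
    using gram_eigenvalue_nonneg[OF M] by (simp add: sigma_min_def)
  then have "(sigma_min M)\<^sup>2 * (\<Sum>c<l. (cmod (y c))\<^sup>2) \<le> \<mu> * (\<Sum>c<l. (cmod (y c))\<^sup>2)"
    by (intro mult_right_mono sum_nonneg) auto
  also note \<mu>[of y]
  finally show ?thesis .
qed

section \<open>Tensors and their Fourier transform\<close>

lemma tensorsD:
  assumes "M \<in> tensors m l n" "0 < n"
  shows "trows M = m" "tcols M = l" "length M = n"
    "\<And>k. k < n \<Longrightarrow> M ! k \<in> carrier_mat m l"
    "\<And>k. k < n \<Longrightarrow> dim_row (M ! k) = m" "\<And>k. k < n \<Longrightarrow> dim_col (M ! k) = l"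
proof -
  show len: "length M = n" using assms by (auto simp: tensors_def)
  show car: "M ! k \<in> carrier_mat m l" if "k < n" for k
    using assms that len by (auto simp: tensors_def)
  from car[OF assms(2)] show "trows M = m" "tcols M = l"
    by (auto simp: trows_def tcols_def)
  show "dim_row (M ! k) = m" "dim_col (M ! k) = l" if "k < n" for k
    using car[OF that] by auto
qed

lemma tensors_eqI:
  assumes "M \<in> tensors m l n" "N \<in> tensors m l n"
    "\<And>k i j. k < n \<Longrightarrow> i < m \<Longrightarrow> j < l \<Longrightarrow> M ! k $$ (i, j) = N ! k $$ (i, j)"
  shows "M = N"
proof (cases "n = 0")
  case True
  then show ?thesis using assms by (simp add: tensors_def)
next
  case False
  then show ?thesis
    using assms by (intro nth_equalityI) (auto simp: tensorsD intro!: eq_matI)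
qed

lemma sum_mult_blocks:
  fixes f :: "nat \<Rightarrow> 'a::comm_monoid_add"
  shows "sum f {..<l * n} = (\<Sum>s<n. \<Sum>c<l. f (s * l + c))"
proof -
  have "sum f {s * l..<s * l + l} = (\<Sum>c<l. f (s * l + c))" for s
    by (rule sum.reindex_bij_witness[of _ "\<lambda>c. s * l + c" "\<lambda>r. r - s * l"]) auto
  moreover have "sum f {..<n * l} = (\<Sum>s<n. sum f {s * l..<s * l + l})"
    by (rule sum.nat_group[symmetric])
  ultimately show ?thesis by (simp add: mult.commute)
qed

lemma block_index_less:
  fixes q i m n :: nat
  assumes "q < n" "i < m"
  shows "q * m + i < m * n"
proof -
  have "q * m + i < Suc q * m" using assms by simp
  also have "\<dots> \<le> n * m" using assms by (intro mult_right_mono) auto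
  finally show ?thesis by (simp add: mult.commute)
qed

lemma tprod_tensors [simp]:
  assumes "A \<in> tensors m l n" "B \<in> tensors l p n" "0 < n"
  shows "A \<star>\<^sub>t B \<in> tensors m p n"
  using tensorsD[OF assms(1,3)] tensorsD[OF assms(2,3)] assms(3)
  by (auto simp: tprod_def tensors_def tfold_def Let_def bcirc_def tunfold_def)

text \<open>In entries the t-product is a cyclic convolution of frontal slices; the Fourier and the
  measurability arguments start from this form.\<close>

lemma tprod_index:
  assumes A: "A \<in> tensors m l n" and B: "B \<in> tensors l p n" and q: "q < n" and i: "i < m" and j: "j < p"
  shows "(A \<star>\<^sub>t B) ! q $$ (i, j) = (\<Sum>s<n. \<Sum>c<l. A ! ((q + n - s) mod n) $$ (i, c) * B ! s $$ (c, j))"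
proof -
  have n: "0 < n" using q by simp
  note D = tensorsD[OF A n] tensorsD[OF B n]
  have lt: "q * m + i < m * n" using q i by (rule block_index_less)
  have "(A \<star>\<^sub>t B) ! q $$ (i, j) = (bcirc A * tunfold B) $$ (q * m + i, j)"
    using q i j n D by (simp add: tprod_def tfold_def bcirc_def tunfold_def Let_def)
  also have "\<dots> = (\<Sum>r<l * n. bcirc A $$ (q * m + i, r) * tunfold B $$ (r, j))"
    using lt j D by (simp add: bcirc_def tunfold_def Let_def scalar_prod_def atLeast0LessThan)
  also have "\<dots> = (\<Sum>s<n. \<Sum>c<l. bcirc A $$ (q * m + i, s * l + c) * tunfold B $$ (s * l + c, j))"
    by (rule sum_mult_blocks)
  also have "\<dots> = (\<Sum>s<n. \<Sum>c<l. A ! ((q + n - s) mod n) $$ (i, c) * B ! s $$ (c, j))"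
    using lt i j D by (intro sum.cong refl) (simp add: bcirc_def tunfold_def Let_def block_index_less)
  finally show ?thesis .
qed

lemma tadjoint_tensors [simp]:
  assumes "A \<in> tensors m l n" "0 < n"
  shows "tadjoint A \<in> tensors l m n"
  using tensorsD[OF assms] assms(2) by (auto simp: tadjoint_def tensors_def)

text \<open>\<open>(n - q) mod n\<close> negates the slice index modulo \<open>n\<close>, which
  merges the special case of slice 0 with the general one.\<close>

lemma tadjoint_index:
  assumes "A \<in> tensors m l n" "q < n" "i < m" "j < l"
  shows "tadjoint A ! q $$ (j, i) = cnj (A ! ((n - q) mod n) $$ (i, j))"
proof -
  have n: "0 < n" using assms by simp
  show ?thesis using tensorsD[OF assms(1) n] assms n by (simp add: tadjoint_def)
qed

lemma tminus_tensors [simp]: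
  assumes "A \<in> tensors m l n" "B \<in> tensors m l n"
  shows "A \<ominus>\<^sub>t B \<in> tensors m l n"
  using assms unfolding tensors_def tminus_def
  by (auto dest!: set_zip_rightD intro!: minus_carrier_mat)

lemma tminus_index:
  assumes "A \<in> tensors m l n" "B \<in> tensors m l n" "q < n" "i < m" "j < l"
  shows "(A \<ominus>\<^sub>t B) ! q $$ (i, j) = A ! q $$ (i, j) - B ! q $$ (i, j)"
proof -
  have n: "0 < n" using assms by simp
  show ?thesis using tensorsD[OF assms(1) n] tensorsD[OF assms(2) n] assms(3-)
    by (simp add: tminus_def)
qed

lemma row_slice_tensors [simp]:
  assumes "A \<in> tensors m l n"
  shows "row_slice A i \<in> tensors 1 l n"
  using assms by (auto simp: row_slice_def tensors_def)

lemma row_slice_index: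
  assumes "A \<in> tensors m l n" "q < n" "j < l"
  shows "row_slice A i ! q $$ (0, j) = A ! q $$ (i, j)"
proof -
  have n: "0 < n" using assms by simp
  show ?thesis using tensorsD[OF assms(1) n] assms(2-) by (simp add: row_slice_def)
qed

lemma tid_tensors [simp]: "tid m n \<in> tensors m m n"
  by (auto simp: tid_def tensors_def)

section \<open>Roots of unity and the one-dimensional discrete Fourier transform\<close>

text \<open>The exponent has the sign used in \<open>dft\<close>, so plain powers of this root form
  the Fourier kernel without its normalisation.\<close>

definition unit_root :: "nat \<Rightarrow> complex" where
  "unit_root n = cis (- (2 * pi / real n))"

lemma unit_root_power: "unit_root n ^ k = cis (- (2 * pi * real k / real n))"
  unfolding unit_root_def Complex.DeMoivre by (simp add: mult_ac)

lemma unit_root_power_n [simp]: "unit_root n ^ n = 1"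
  by (cases "n = 0") (auto simp: unit_root_power complex_eq_iff)

lemma unit_root_cnj [simp]:
  "cnj (unit_root n) * unit_root n = 1" "unit_root n * cnj (unit_root n) = 1"
  by (simp_all add: unit_root_def cis_cnj cis_mult)

lemma unit_root_nonzero [simp]: "unit_root n \<noteq> 0"
  by (simp add: unit_root_def)

lemma unit_root_power_cnj:
  "cnj (unit_root n) ^ k * unit_root n ^ k = 1" "unit_root n ^ k * cnj (unit_root n) ^ k = 1"
  by (simp_all add: power_mult_distrib[symmetric])

text \<open>Exponents count modulo \<open>n\<close>; this absorbs the wrap-around when a cyclic
  slice index is substituted.\<close>

lemma unit_root_power_mod [simp]: "unit_root n ^ ((a mod n) * k) = unit_root n ^ (a * k)"
proof -
  have "unit_root n ^ (a * k) = unit_root n ^ ((n * (a div n) + a mod n) * k)" by simp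
  also have "\<dots> = (unit_root n ^ n) ^ ((a div n) * k) * unit_root n ^ ((a mod n) * k)"
    by (simp only: power_mult[symmetric] power_add[symmetric] add_mult_distrib mult.assoc)
  finally show ?thesis by simp
qed

text \<open>A cosine equal to 1 forces the angle to be a multiple of \<open>2 * pi\<close>, hence
  \<open>n\<close> to divide \<open>k\<close>.\<close>

lemma unit_root_power_neq_1:
  assumes "0 < k" "k < n"
  shows "unit_root n ^ k \<noteq> 1"
proof
  assume "unit_root n ^ k = 1"
  then have "cos (2 * pi * real k / real n) = 1"
    by (simp add: unit_root_power complex_eq_iff)
  then obtain z :: int where "2 * pi * real k / real n = real_of_int z * 2 * pi"
    by (auto simp: cos_one_2pi_int)
  then have "real k = real_of_int z * real n" using assms by (simp add: field_simps)
  then have "int k = z * int n" by (metis of_int_eq_iff of_int_mult of_int_of_nat_eq)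
  then have "int n dvd int k" by simp
  then show False using assms by (auto dest: dvd_imp_le)
qed

lemma unit_root_orthogonal:
  assumes "r < n" "s < n"
  shows "(\<Sum>k<n. unit_root n ^ (k * r) * cnj (unit_root n ^ (k * s))) = (if r = s then of_nat n else 0)"
proof -
  \<comment> \<open>\<open>z\<close> is the root to the power \<open>r - s\<close>, with conjugates
    in place of negative exponents; the sum becomes geometric.\<close>
  define z where "z = unit_root n ^ r * cnj (unit_root n) ^ s"
  have eq: "unit_root n ^ (k * r) * cnj (unit_root n ^ (k * s)) = z ^ k" for k
    by (simp add: z_def power_mult_distrib power_mult[symmetric] mult.commute)
  show ?thesis
  proof (cases "r = s")
    case True
    then have "z = 1" by (simp add: z_def unit_root_power_cnj)
    then show ?thesis using True unfolding eq by simp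
  next
    case False
    have zn: "z ^ n = 1"
      by (simp add: z_def power_mult_distrib power_mult[symmetric] mult.commute[of _ n])
        (simp add: power_mult flip: complex_cnj_power)
    have "z \<noteq> 1"
    proof
      assume "z = 1"
      then have "unit_root n ^ r * cnj (unit_root n) ^ s * unit_root n ^ s = unit_root n ^ s"
        by (simp add: z_def)
      then have *: "unit_root n ^ r = unit_root n ^ s"
        by (simp add: mult.assoc unit_root_power_cnj)
      show False
      proof (cases "r < s")
        case True
        then have "unit_root n ^ r * unit_root n ^ (s - r) = unit_root n ^ s"
          by (simp flip: power_add)
        then show False using unit_root_power_neq_1[of "s - r" n] True assms by (simp add: *)
      next
        case False
        then have "unit_root n ^ s * unit_root n ^ (r - s) = unit_root n ^ r"
          by (simp flip: power_add)
        then show False using unit_root_power_neq_1[of "r - s" n] False \<open>r \<noteq> s\<close> assms by (simp add: *)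
      qed
    qed
    then have "(\<Sum>k<n. z ^ k) = 0" using zn by (simp add: sum_gp_strict)
    then show ?thesis using False unfolding eq by simp
  qed
qed

text \<open>After expanding the square, summing over \<open>k\<close> first leaves only the diagonal
  by orthogonality. The transform is not normalised, hence the factor \<open>n\<close>.\<close>

lemma dft_parseval:
  "(\<Sum>k<n. (cmod (\<Sum>q<n. unit_root n ^ (k * q) * z q))\<^sup>2) = real n * (\<Sum>q<n. (cmod (z q))\<^sup>2)"
proof -
  let ?w = "unit_root n"
  have "complex_of_real (\<Sum>k<n. (cmod (\<Sum>q<n. ?w ^ (k * q) * z q))\<^sup>2) =
    (\<Sum>k<n. \<Sum>r<n. \<Sum>s<n. (z r * cnj (z s)) * (?w ^ (k * r) * cnj (?w ^ (k * s))))"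
    unfolding of_real_sum complex_norm_square
    by (simp add: sum_product mult_ac del: of_real_power)
  also have "\<dots> = (\<Sum>r<n. \<Sum>k<n. \<Sum>s<n. (z r * cnj (z s)) * (?w ^ (k * r) * cnj (?w ^ (k * s))))"
    by (rule sum.swap)
  also have "\<dots> = (\<Sum>r<n. \<Sum>s<n. \<Sum>k<n. (z r * cnj (z s)) * (?w ^ (k * r) * cnj (?w ^ (k * s))))"
    by (intro sum.cong refl sum.swap)
  also have "\<dots> = (\<Sum>r<n. \<Sum>s<n. (z r * cnj (z s)) * (if r = s then of_nat n else 0))"
    unfolding sum_distrib_left[symmetric] by (intro sum.cong refl) (simp only: lessThan_iff unit_root_orthogonal)
  also have "\<dots> = (\<Sum>r<n. of_nat n * (z r * cnj (z r)))"
    by (intro sum.cong refl) (simp add: if_distrib[of "(*) _"] mult.commute cong: if_cong)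
  also have "\<dots> = complex_of_real (real n * (\<Sum>q<n. (cmod (z q))\<^sup>2))"
    by (simp add: sum_distrib_left complex_norm_square del: of_real_power)
  finally show ?thesis by (simp only: of_real_eq_iff)
qed

text \<open>Substituting \<open>q = r + s\<close> modulo \<open>n\<close> turns a cyclic shift into
  a phase. Both the convolution rule \<open>tft_tprod\<close> and the block diagonalisation in
  \<open>fourier3_index\<close> rest on it.\<close>

lemma dft_shift:
  assumes s: "s < n"
  shows "(\<Sum>q<n. unit_root n ^ (q * k) * z ((q + n - s) mod n)) = unit_root n ^ (s * k) * (\<Sum>q<n. unit_root n ^ (q * k) * z q)"
proof -
  let ?w = "unit_root n"
  have n: "0 < n" using s by simp
  have "(\<Sum>q<n. ?w ^ (q * k) * z ((q + n - s) mod n)) = (\<Sum>r<n. ?w ^ (((r + s) mod n) * k) * z r)"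
  proof (rule sum.reindex_bij_witness[of _ "\<lambda>r. (r + s) mod n" "\<lambda>q. (q + n - s) mod n"])
    fix q assume "q \<in> {..<n}"
    then show *: "((q + n - s) mod n + s) mod n = q"
      using s by (simp add: mod_add_left_eq)
    then show "?w ^ (((q + n - s) mod n + s) mod n * k) * z ((q + n - s) mod n) =
      ?w ^ (q * k) * z ((q + n - s) mod n)" by simp
    show "(q + n - s) mod n \<in> {..<n}" using n by simp
  next
    fix r assume r: "r \<in> {..<n}"
    show "(r + s) mod n \<in> {..<n}" using n by simp
    have "((r + s) mod n + n - s) mod n = ((r + s) mod n + (n - s)) mod n" using s by simp
    also have "\<dots> = (r + s + (n - s)) mod n" by (rule mod_add_left_eq)
    also have "\<dots> = r" using r s by simp
    finally show "((r + s) mod n + n - s) mod n = r" .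
  qed
  also have "\<dots> = ?w ^ (s * k) * (\<Sum>q<n. ?w ^ (q * k) * z q)"
    unfolding unit_root_power_mod
    by (simp add: sum_distrib_left algebra_simps power_add)
  finally show ?thesis .
qed

section \<open>The transform of a tensor and its algebraic rules\<close>

text \<open>The unnormalised transform along each tube. The contraction argument works with it;
  \<open>fourier3_index\<close> identifies it with the diagonal blocks that define
  \<open>fourier3\<close>.\<close>

definition tft :: "tensor \<Rightarrow> nat \<Rightarrow> nat \<Rightarrow> nat \<Rightarrow> complex" where
  "tft M k i j = (\<Sum>q<length M. unit_root (length M) ^ (q * k) * M ! q $$ (i, j))"

lemma tft_eq:
  assumes "M \<in> tensors m l n" "0 < n"
  shows "tft M k i j = (\<Sum>q<n. unit_root n ^ (q * k) * M ! q $$ (i, j))"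
  using tensorsD[OF assms] by (simp add: tft_def)

lemma frob_norm_tft:
  assumes "M \<in> tensors m l n" "0 < n"
  shows "(frob_norm M)\<^sup>2 = (\<Sum>k<n. \<Sum>i<m. \<Sum>j<l. (cmod (tft M k i j))\<^sup>2) / real n"
proof -
  have "(\<Sum>k<n. \<Sum>i<m. \<Sum>j<l. (cmod (tft M k i j))\<^sup>2) = (\<Sum>i<m. \<Sum>k<n. \<Sum>j<l. (cmod (tft M k i j))\<^sup>2)"
    by (rule sum.swap)
  also have "\<dots> = (\<Sum>i<m. \<Sum>j<l. \<Sum>k<n. (cmod (tft M k i j))\<^sup>2)"
    by (intro sum.cong refl sum.swap)
  also have "\<dots> = (\<Sum>i<m. \<Sum>j<l. real n * (\<Sum>q<n. (cmod (M ! q $$ (i, j)))\<^sup>2))"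
    by (intro sum.cong refl) (simp add: tft_eq[OF assms] dft_parseval[symmetric] mult.commute)
  also have "\<dots> = real n * (\<Sum>i<m. \<Sum>j<l. \<Sum>q<n. (cmod (M ! q $$ (i, j)))\<^sup>2)"
    by (simp add: sum_distrib_left)
  also have "(\<Sum>i<m. \<Sum>j<l. \<Sum>q<n. (cmod (M ! q $$ (i, j)))\<^sup>2) = (\<Sum>i<m. \<Sum>q<n. \<Sum>j<l. (cmod (M ! q $$ (i, j)))\<^sup>2)"
    by (intro sum.cong refl sum.swap)
  also have "\<dots> = (\<Sum>q<n. \<Sum>i<m. \<Sum>j<l. (cmod (M ! q $$ (i, j)))\<^sup>2)"
    by (rule sum.swap)
  also have "\<dots> = (frob_norm M)\<^sup>2"
    unfolding frob_norm_def using tensorsD[OF assms]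
    by (subst real_sqrt_pow2) (auto intro!: sum_nonneg sum.cong)
  finally show ?thesis using assms(2) by simp
qed

lemma tft_tminus:
  assumes "A \<in> tensors m l n" "B \<in> tensors m l n" "0 < n" "i < m" "j < l"
  shows "tft (A \<ominus>\<^sub>t B) k i j = tft A k i j - tft B k i j"
  using assms
  by (simp add: tft_eq[of _ m l n] tminus_index right_diff_distrib sum_subtractf)

lemma tft_row_slice:
  assumes "A \<in> tensors m l n" "0 < n" "j < l"
  shows "tft (row_slice A i) k 0 j = tft A k i j"
  using assms
  by (simp add: tft_eq[OF assms(1,2)] tft_eq[OF row_slice_tensors[OF assms(1)] assms(2)] row_slice_index)

lemma tft_tid:
  assumes "0 < n" "i < m" "j < m"
  shows "tft (tid m n) k i j = (if i = j then 1 else 0)"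
proof -
  have "tft (tid m n) k i j = (\<Sum>q<n. if q = 0 then if i = j then 1 else 0 else 0)"
    unfolding tft_eq[OF tid_tensors assms(1)] using assms
    by (intro sum.cong refl) (auto simp: tid_def)
  then show ?thesis using assms by simp
qed

text \<open>By Parseval, a tube whose transform vanishes has zero energy; this is applied to the
  difference of \<open>A\<close> and \<open>B\<close>.\<close>

lemma tft_inject:
  assumes "A \<in> tensors m l n" "B \<in> tensors m l n"
    "\<And>k i j. k < n \<Longrightarrow> i < m \<Longrightarrow> j < l \<Longrightarrow> tft A k i j = tft B k i j"
  shows "A = B"
proof (rule tensors_eqI[OF assms(1,2)])
  fix q i j assume q: "q < n" and i: "i < m" and j: "j < l"
  then have n: "0 < n" by simp
  let ?z = "\<lambda>q. A ! q $$ (i, j) - B ! q $$ (i, j)"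
  have "(\<Sum>q<n. unit_root n ^ (k * q) * ?z q) = 0" if "k < n" for k
    using assms(3)[OF that i j]
    by (simp add: tft_eq[OF assms(1) n] tft_eq[OF assms(2) n] right_diff_distrib sum_subtractf mult.commute)
  then have "real n * (\<Sum>q<n. (cmod (?z q))\<^sup>2) = 0"
    unfolding dft_parseval[symmetric] by simp
  then have "\<forall>q\<in>{..<n}. (cmod (?z q))\<^sup>2 = 0"
    using n by (subst (asm) mult_eq_0_iff) (auto simp: sum_nonneg_eq_0_iff)
  then show "A ! q $$ (i, j) = B ! q $$ (i, j)" using q by simp
qed

text \<open>Once the sum over \<open>q\<close> is innermost it meets only shifted slices of
  \<open>A\<close> and gives a phase times \<open>tft A\<close>; the phases then assemble
  \<open>tft B\<close>.\<close>

lemma tft_tprod: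
  assumes A: "A \<in> tensors m l n" and B: "B \<in> tensors l p n" and n: "0 < n" and i: "i < m" and j: "j < p"
  shows "tft (A \<star>\<^sub>t B) k i j = (\<Sum>c<l. tft A k i c * tft B k c j)"
proof -
  let ?w = "unit_root n"
  have shift: "(\<Sum>q<n. ?w ^ (q * k) * A ! ((q + n - s) mod n) $$ (i, c)) = ?w ^ (s * k) * tft A k i c"
    if "s < n" for s c
    using dft_shift[OF that, of k "\<lambda>q. A ! q $$ (i, c)"] by (simp add: tft_eq[OF A n])
  have "tft (A \<star>\<^sub>t B) k i j =
    (\<Sum>q<n. \<Sum>s<n. \<Sum>c<l. B ! s $$ (c, j) * (?w ^ (q * k) * A ! ((q + n - s) mod n) $$ (i, c)))"
    by (simp add: tft_eq[OF tprod_tensors[OF A B n] n] tprod_index[OF A B _ i j] sum_distrib_left mult_ac)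
  also have "\<dots> = (\<Sum>s<n. \<Sum>q<n. \<Sum>c<l. B ! s $$ (c, j) * (?w ^ (q * k) * A ! ((q + n - s) mod n) $$ (i, c)))"
    by (rule sum.swap)
  also have "\<dots> = (\<Sum>s<n. \<Sum>c<l. \<Sum>q<n. B ! s $$ (c, j) * (?w ^ (q * k) * A ! ((q + n - s) mod n) $$ (i, c)))"
    by (intro sum.cong refl sum.swap)
  also have "\<dots> = (\<Sum>s<n. \<Sum>c<l. B ! s $$ (c, j) * (?w ^ (s * k) * tft A k i c))"
    by (intro sum.cong refl) (simp add: shift flip: sum_distrib_left)
  also have "\<dots> = (\<Sum>c<l. \<Sum>s<n. B ! s $$ (c, j) * (?w ^ (s * k) * tft A k i c))"
    by (rule sum.swap)
  also have "\<dots> = (\<Sum>c<l. tft A k i c * tft B k c j)"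
    by (simp add: tft_eq[OF B n] sum_distrib_left mult_ac)
  finally show ?thesis .
qed

text \<open>Negating the slice index conjugates the root, since \<open>w ^ ((n - r) * k)\<close> is
  the conjugate of \<open>w ^ (r * k)\<close>.\<close>

lemma tft_tadjoint:
  assumes A: "A \<in> tensors m l n" and n: "0 < n" and i: "i < m" and j: "j < l"
  shows "tft (tadjoint A) k j i = cnj (tft A k i j)"
proof -
  let ?w = "unit_root n"
  have invol: "(n - (n - q) mod n) mod n = q" if "q < n" for q
    using that by (cases "q = 0") auto
  have "tft (tadjoint A) k j i = (\<Sum>q<n. ?w ^ (q * k) * cnj (A ! ((n - q) mod n) $$ (i, j)))"
    using i j by (simp add: tft_eq[OF tadjoint_tensors[OF A n] n] tadjoint_index[OF A])
  also have "\<dots> = (\<Sum>r<n. ?w ^ (((n - r) mod n) * k) * cnj (A ! r $$ (i, j)))"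
    by (rule sum.reindex_bij_witness[of _ "\<lambda>r. (n - r) mod n" "\<lambda>r. (n - r) mod n"])
      (use n in \<open>simp_all add: invol\<close>)
  also have "\<dots> = (\<Sum>r<n. cnj (?w ^ (r * k) * A ! r $$ (i, j)))"
  proof (intro sum.cong refl)
    fix r assume "r \<in> {..<n}"
    then have "?w ^ ((n - r) * k) * ?w ^ (r * k) = ?w ^ (n * k)"
      by (simp flip: power_add add_mult_distrib)
    also have "\<dots> = 1" unfolding power_mult by simp
    finally have "?w ^ ((n - r) * k) * ?w ^ (r * k) = 1" .
    then have "?w ^ ((n - r) * k) * (?w ^ (r * k) * cnj ?w ^ (r * k)) = cnj ?w ^ (r * k)"
      by (simp flip: mult.assoc)
    then have "?w ^ ((n - r) * k) = cnj (?w ^ (r * k))"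
      by (simp add: unit_root_power_cnj)
    then show "?w ^ (((n - r) mod n) * k) * cnj (A ! r $$ (i, j)) = cnj (?w ^ (r * k) * A ! r $$ (i, j))"
      by simp
  qed
  also have "\<dots> = cnj (tft A k i j)" by (simp add: tft_eq[OF A n])
  finally show ?thesis .
qed

section \<open>Agreement with the block diagonalisation of \<open>bcirc\<close>\<close>

lemma mult_mat_index:
  assumes "M \<in> carrier_mat a b" "N \<in> carrier_mat b c" "i < a" "j < c"
  shows "(M * N) $$ (i, j) = (\<Sum>r<b. M $$ (i, r) * N $$ (r, j))"
  using assms by (simp add: scalar_prod_def atLeast0LessThan)

lemma dft_index:
  assumes "j < n" "k < n"
  shows "dft n $$ (j, k) = unit_root n ^ (j * k) / complex_of_real (sqrt (real n))"
proof -
  have "- (2 * complex_of_real pi * \<i> * of_nat j * of_nat k / of_nat n) =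
    \<i> * complex_of_real (- (2 * pi * real (j * k) / real n))" by simp
  then have "exp (- (2 * complex_of_real pi * \<i> * of_nat j * of_nat k / of_nat n)) = unit_root n ^ (j * k)"
    by (simp only: unit_root_power cis_conv_exp)
  then show ?thesis using assms by (simp add: dft_def)
qed

text \<open>The identity factors of the Kronecker products collapse the inner sums. The left factor
  transforms a block column; block column \<open>s\<close> is the first one shifted cyclically by
  \<open>s\<close>, which yields a phase that the right factor cancels.\<close>

lemma fourier3_index:
  assumes A: "A \<in> tensors m l n" and k: "k < n" and i: "i < m" and j: "j < l"
  shows "fourier3 A ! k $$ (i, j) = tft A k i j"
proof -
  have n: "0 < n" using k by simp
  note D = tensorsD[OF A n]
  let ?w = "unit_root n"
  let ?K = "kronecker (dft n) (1\<^sub>m m)" and ?L = "kronecker (mat_adjoint (dft n)) (1\<^sub>m l)"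
  let ?R = "complex_of_real (sqrt (real n))"
  have dims: "dim_row (dft n) = n" "dim_col (dft n) = n" by (simp_all add: dft_def)
  have K: "?K \<in> carrier_mat (m * n) (m * n)" and L: "?L \<in> carrier_mat (l * n) (l * n)"
    by (auto simp: kronecker_def dims mult.commute)
  have C: "bcirc A \<in> carrier_mat (m * n) (l * n)" using D by (auto simp: bcirc_def Let_def)
  have row: "k * m + i < m * n" using k i by (rule block_index_less)
  have col: "k * l + j < l * n" using k j by (rule block_index_less)
  have Kent: "?K $$ (k * m + i, r * m + c) = (if c = i then ?w ^ (k * r) / ?R else 0)"
    if "r < n" "c < m" for r c
    using that k i by (simp add: kronecker_def dims block_index_less mult.commute[of n] dft_index)
  have Lent: "?L $$ (s * l + c, k * l + j) = (if c = j then cnj (?w ^ (k * s)) / ?R else 0)"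
    if "s < n" "c < l" for s c
    using that k j by (simp add: kronecker_def dims block_index_less mult.commute[of n] dft_index)
  have KC: "(?K * bcirc A) $$ (k * m + i, s * l + c) = (\<Sum>r<n. ?w ^ (k * r) / ?R * A ! ((r + n - s) mod n) $$ (i, c))"
    if s: "s < n" and c: "c < l" for s c
  proof -
    have "(?K * bcirc A) $$ (k * m + i, s * l + c) =
      (\<Sum>r<m * n. ?K $$ (k * m + i, r) * bcirc A $$ (r, s * l + c))"
      using K C row block_index_less[OF s c] by (rule mult_mat_index)
    also have "\<dots> = (\<Sum>r<n. \<Sum>d<m. ?K $$ (k * m + i, r * m + d) * bcirc A $$ (r * m + d, s * l + c))"
      by (rule sum_mult_blocks)
    also have "\<dots> = (\<Sum>r<n. \<Sum>d<m. if d = i then ?w ^ (k * r) / ?R * bcirc A $$ (r * m + d, s * l + c) else 0)"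
      by (intro sum.cong refl) (simp add: Kent)
    also have "\<dots> = (\<Sum>r<n. ?w ^ (k * r) / ?R * bcirc A $$ (r * m + i, s * l + c))"
      using i by simp
    also have "\<dots> = (\<Sum>r<n. ?w ^ (k * r) / ?R * A ! ((r + n - s) mod n) $$ (i, c))"
      using i s c D by (intro sum.cong refl) (simp add: bcirc_def Let_def block_index_less)
    finally show ?thesis .
  qed
  have "fourier3 A ! k $$ (i, j) = (?K * bcirc A * ?L) $$ (k * m + i, k * l + j)"
    using D k i j by (simp add: fourier3_def Let_def)
  also have "\<dots> = (\<Sum>r<l * n. (?K * bcirc A) $$ (k * m + i, r) * ?L $$ (r, k * l + j))"
    using mult_carrier_mat[OF K C] L row col by (rule mult_mat_index)
  also have "\<dots> = (\<Sum>s<n. \<Sum>c<l. (?K * bcirc A) $$ (k * m + i, s * l + c) * ?L $$ (s * l + c, k * l + j))"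
    by (rule sum_mult_blocks)
  also have "\<dots> = (\<Sum>s<n. \<Sum>c<l. if c = j then (?K * bcirc A) $$ (k * m + i, s * l + c) * (cnj (?w ^ (k * s)) / ?R) else 0)"
    by (intro sum.cong refl) (simp add: Lent del: index_mult_mat(1))
  also have "\<dots> = (\<Sum>s<n. (?K * bcirc A) $$ (k * m + i, s * l + j) * (cnj (?w ^ (k * s)) / ?R))"
    using j by simp
  also have "\<dots> = (\<Sum>s<n. (\<Sum>r<n. ?w ^ (k * r) * A ! ((r + n - s) mod n) $$ (i, j)) * cnj (?w ^ (k * s)) / of_nat n)"
  proof (intro sum.cong refl)
    fix s assume s: "s \<in> {..<n}"
    have "(?K * bcirc A) $$ (k * m + i, s * l + j) =
       (\<Sum>r<n. ?w ^ (k * r) * A ! ((r + n - s) mod n) $$ (i, j)) / ?R"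
      using s by (simp add: KC j sum_divide_distrib del: index_mult_mat(1))
    moreover have "?R * ?R = of_nat n" by (simp flip: of_real_mult)
    ultimately show "(?K * bcirc A) $$ (k * m + i, s * l + j) * (cnj (?w ^ (k * s)) / ?R) =
      (\<Sum>r<n. ?w ^ (k * r) * A ! ((r + n - s) mod n) $$ (i, j)) * cnj (?w ^ (k * s)) / of_nat n"
      by (simp add: times_divide_times_eq del: index_mult_mat(1))
  qed
  \<comment> \<open>All \<open>n\<close> summands agree once the phases cancel; the two factors
    \<open>1 / sqrt n\<close> turn their sum into a mean.\<close>
  also have "\<dots> = (\<Sum>s<n. tft A k i j / of_nat n)"
  proof (intro sum.cong refl)
    fix s assume "s \<in> {..<n}"
    then have s: "s < n" by simp
    have "(\<Sum>r<n. ?w ^ (k * r) * A ! ((r + n - s) mod n) $$ (i, j)) = ?w ^ (k * s) * tft A k i j"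
      using dft_shift[OF s, of k "\<lambda>q. A ! q $$ (i, j)"] by (simp add: tft_eq[OF A n] mult.commute)
    then have "(\<Sum>r<n. ?w ^ (k * r) * A ! ((r + n - s) mod n) $$ (i, j)) * cnj (?w ^ (k * s)) =
      tft A k i j * (?w ^ (k * s) * cnj (?w ^ (k * s)))"
      by (simp only: mult_ac)
    also have "\<dots> = tft A k i j" by (simp add: unit_root_power_cnj)
    finally show "(\<Sum>r<n. ?w ^ (k * r) * A ! ((r + n - s) mod n) $$ (i, j)) * cnj (?w ^ (k * s)) / of_nat n = tft A k i j / of_nat n"
      by simp
  qed
  also have "\<dots> = tft A k i j" using n by simp
  finally show ?thesis .
qed

section \<open>Contraction of the error\<close>

lemma fourier3_carrier:
  assumes "A \<in> tensors m l n" "k < n"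
  shows "fourier3 A ! k \<in> carrier_mat m l"
proof -
  have "0 < n" using assms by simp
  then show ?thesis using tensorsD[OF assms(1)] assms(2) by (simp add: fourier3_def Let_def)
qed

lemma norm_inf_2_row:
  assumes "M \<in> carrier_mat m l" "r < m"
  shows "(\<Sum>c<l. (cmod (M $$ (r, c)))\<^sup>2) \<le> (norm_inf_2 M)\<^sup>2"
proof -
  have "sqrt (\<Sum>c<l. (cmod (M $$ (r, c)))\<^sup>2) \<le> norm_inf_2 M"
    unfolding norm_inf_2_def using assms by (intro Max_ge) auto
  then show ?thesis by (simp add: sqrt_le_D)
qed

text \<open>Transforms of \<open>1 x 1\<close> tubes multiply as scalars in each slice, so both
  candidates are the same reciprocal. This justifies the \<open>THE\<close> in
  \<open>tinv\<close>.\<close>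

lemma tinverts_unique:
  assumes "tinverts M N" "tinverts M N'" "M \<in> tensors 1 1 n" "0 < n"
  shows "N = N'"
proof -
  have D: "trows M = 1" "length M = n" using tensorsD[OF assms(3,4)] by auto
  have *: "N \<in> tensors 1 1 n" "N' \<in> tensors 1 1 n" "M \<star>\<^sub>t N = tid 1 n" "M \<star>\<^sub>t N' = tid 1 n"
    using assms(1,2) by (auto simp: tinverts_def Let_def D)
  show ?thesis
  proof (rule tft_inject[OF *(1,2)])
    fix k i j :: nat assume k: "k < n" and ij: "i < 1" "j < 1"
    have "tft M k 0 0 * tft N k 0 0 = 1" "tft M k 0 0 * tft N' k 0 0 = 1"
      using arg_cong[OF *(3), of "\<lambda>T. tft T k 0 0"] arg_cong[OF *(4), of "\<lambda>T. tft T k 0 0"]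
      by (simp_all add: tft_tprod[OF assms(3) *(1) assms(4)] tft_tprod[OF assms(3) *(2) assms(4)]
          tft_tid[OF assms(4)])
    then have "tft N k 0 0 = tft N' k 0 0"
      by (metis mult.assoc mult.commute mult.right_neutral)
    then show "tft N k i j = tft N' k i j" using ij by simp
  qed
qed

lemma tinv_scalar:
  assumes "M \<in> tensors 1 1 n" "0 < n" "tinvertible M"
  shows "tinv M \<in> tensors 1 1 n" "tft M k 0 0 * tft (tinv M) k 0 0 = 1"
proof -
  obtain N where "tinverts M N" using assms by (auto simp: tinvertible_def)
  then have inv: "tinverts M (tinv M)"
    unfolding tinv_def by (rule theI) (use tinverts_unique assms(1,2) \<open>tinverts M N\<close> in blast)
  have D: "trows M = 1" "length M = n" using tensorsD[OF assms(1,2)] by auto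
  show T: "tinv M \<in> tensors 1 1 n" using inv by (auto simp: tinverts_def Let_def D)
  have "M \<star>\<^sub>t tinv M = tid 1 n" using inv by (auto simp: tinverts_def Let_def D)
  from arg_cong[OF this, of "\<lambda>T. tft T k 0 0"] show "tft M k 0 0 * tft (tinv M) k 0 0 = 1"
    by (simp add: tft_tprod[OF assms(1) T assms(2)] tft_tid[OF assms(2)])
qed

lemma tprod_row_gram_tensors:
  assumes "A \<in> tensors m l n" "0 < n"
  shows "row_slice A j \<star>\<^sub>t tadjoint (row_slice A j) \<in> tensors 1 1 n"
  using row_slice_tensors[OF assms(1)] assms(2) by (meson tprod_tensors tadjoint_tensors)

lemma tft_row_gram:
  assumes A: "A \<in> tensors m l n" and n: "0 < n"
  shows "tft (row_slice A j \<star>\<^sub>t tadjoint (row_slice A j)) k 0 0 =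
    complex_of_real (\<Sum>c<l. (cmod (tft A k j c))\<^sup>2)"
proof -
  have a: "row_slice A j \<in> tensors 1 l n" by (rule row_slice_tensors[OF A])
  show ?thesis
    by (simp add: tft_tprod[OF a tadjoint_tensors[OF a n] n] tft_tadjoint[OF a n]
        tft_row_slice[OF A n] complex_norm_square del: of_real_power)
qed

section \<open>A single step as an orthogonal projection\<close>

definition kaczmarz_step :: "tensor \<Rightarrow> tensor \<Rightarrow> nat \<Rightarrow> tensor \<Rightarrow> tensor" where
  "kaczmarz_step A B j X = (let a = row_slice A j in
     X \<ominus>\<^sub>t tadjoint a \<star>\<^sub>t tinv (a \<star>\<^sub>t tadjoint a) \<star>\<^sub>t (a \<star>\<^sub>t X \<ominus>\<^sub>t row_slice B j))"

lemma kaczmarz_Suc: "kaczmarz A B X0 i (Suc t) = kaczmarz_step A B (i t) (kaczmarz A B X0 i t)"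
  by (simp add: kaczmarz_step_def Let_def)

text \<open>Only a prefix of the index sequence matters, so a random sequence may be replaced by its
  finite restriction, and changing the index at position \<open>t\<close> leaves the iterate after
  \<open>t\<close> steps intact.\<close>

lemma kaczmarz_cong:
  "(\<And>s. s < t \<Longrightarrow> i s = i' s) \<Longrightarrow> kaczmarz A B X0 i t = kaczmarz A B X0 i' t"
  by (induction t) (simp_all add: Let_def)

text \<open>Pythagoras: the subtracted vector is the orthogonal projection of \<open>e\<close> on
  the conjugate of \<open>\<alpha>\<close>, and both its squared norm and the cross term equal
  \<open>|S|^2 / N\<close>.\<close>

lemma projection_norm:
  fixes \<alpha> e :: "nat \<Rightarrow> complex"
  assumes N: "N = (\<Sum>c<l. (cmod (\<alpha> c))\<^sup>2)" "N \<noteq> 0" and S: "S = (\<Sum>c<l. \<alpha> c * e c)"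
  shows "(\<Sum>c<l. (cmod (e c - cnj (\<alpha> c) * (S / complex_of_real N)))\<^sup>2) =
    (\<Sum>c<l. (cmod (e c))\<^sup>2) - (cmod S)\<^sup>2 / N"
proof -
  have "(\<Sum>c<l. Re (cnj (cnj (\<alpha> c) * (S / complex_of_real N)) * e c)) =
      Re (\<Sum>c<l. cnj S / complex_of_real N * (\<alpha> c * e c))"
    by (simp add: mult_ac)
  also have "\<dots> = Re (cnj S / complex_of_real N * S)"
    unfolding S sum_distrib_left ..
  also have "cnj S / complex_of_real N * S = complex_of_real ((cmod S)\<^sup>2 / N)"
    by (simp add: complex_norm_square mult.commute del: of_real_power)
  finally have cross: "(\<Sum>c<l. Re (cnj (cnj (\<alpha> c) * (S / complex_of_real N)) * e c)) = (cmod S)\<^sup>2 / N"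
    by (simp only: Re_complex_of_real)
  have "(\<Sum>c<l. (cmod (cnj (\<alpha> c) * (S / complex_of_real N)))\<^sup>2) = (\<Sum>c<l. (cmod (\<alpha> c))\<^sup>2 * ((cmod S)\<^sup>2 / N\<^sup>2))"
    by (simp add: norm_mult norm_divide power_mult_distrib power_divide)
  also have "\<dots> = N * ((cmod S)\<^sup>2 / N\<^sup>2)"
    unfolding N(1) sum_distrib_right ..
  also have "\<dots> = (cmod S)\<^sup>2 / N" using N(2) by (simp add: power2_eq_square)
  finally show ?thesis
    unfolding cmod_diff_square sum.distrib sum_subtractf sum_distrib_left[symmetric]
    using cross by simp
qed

section \<open>Error bounds for a consistent system\<close>

context
  fixes m l n p :: nat and A B Xs :: tensor
  assumes m: "0 < m" and n: "0 < n"
    and A: "A \<in> tensors m l n"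
    and inv: "\<And>j. j < m \<Longrightarrow> tinvertible (row_slice A j \<star>\<^sub>t tadjoint (row_slice A j))"
    and B: "B \<in> tensors m p n"
    and Xs: "Xs \<in> tensors l p n"
    and AXs: "A \<star>\<^sub>t Xs = B"
begin

definition row_energy :: "nat \<Rightarrow> nat \<Rightarrow> real" where
  "row_energy k j = (\<Sum>c<l. (cmod (tft A k j c))\<^sup>2)"

text \<open>The row energies are the transform of the row Gram tube; invertibility of the tube gives
  each of them a reciprocal.\<close>

lemma row_energy_pos:
  assumes "j < m"
  shows "0 < row_energy k j"
proof -
  have "complex_of_real (row_energy k j) * tft (tinv (row_slice A j \<star>\<^sub>t tadjoint (row_slice A j))) k 0 0 = 1"
    using tinv_scalar(2)[OF tprod_row_gram_tensors[OF A n] n inv[OF assms], of k]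
    by (simp add: tft_row_gram[OF A n] row_energy_def)
  then have "row_energy k j \<noteq> 0" by auto
  moreover have "0 \<le> row_energy k j" unfolding row_energy_def by (intro sum_nonneg) auto
  ultimately show ?thesis by simp
qed

text \<open>A row without columns would have zero energy, so invertibility for row 0 excludes
  \<open>l = 0\<close>, as \<open>sigma_min_bound\<close> requires.\<close>

lemma l_pos: "0 < l"
  using row_energy_pos[OF m, of 0] unfolding row_energy_def by (intro gr0I) simp

lemma step_factor_tensors:
  assumes "j < m" 
  shows "tadjoint (row_slice A j) \<star>\<^sub>t tinv (row_slice A j \<star>\<^sub>t tadjoint (row_slice A j)) \<in> tensors l 1 n"
  by (rule tprod_tensors[OF tadjoint_tensors[OF row_slice_tensors[OF A] n]
      tinv_scalar(1)[OF tprod_row_gram_tensors[OF A n] n inv[OF assms]] n])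

lemma step_residual_tensors:
  assumes "X \<in> tensors l p n"
  shows "row_slice A j \<star>\<^sub>t X \<ominus>\<^sub>t row_slice B j \<in> tensors 1 p n"
  using tprod_tensors[OF row_slice_tensors[OF A] assms n] row_slice_tensors[OF B]
  by (rule tminus_tensors)

lemma kaczmarz_step_tensors:
  assumes "j < m" "X \<in> tensors l p n"
  shows "kaczmarz_step A B j X \<in> tensors l p n"
  unfolding kaczmarz_step_def Let_def
  using assms step_factor_tensors step_residual_tensors n by (meson tminus_tensors tprod_tensors)

lemma kaczmarz_tensors:
  assumes "X \<in> tensors l p n" "\<And>s. s < t \<Longrightarrow> i s < m"
  shows "kaczmarz A B X i t \<in> tensors l p n"
  using assms(2) by (induction t) (simp_all add: assms(1) kaczmarz_step_tensors kaczmarz_Suc del: kaczmarz.simps(2))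

lemma tft_kaczmarz_step:
  assumes j: "j < m" and X: "X \<in> tensors l p n" and c: "c < l" and d: "d < p"
  defines "E \<equiv> X \<ominus>\<^sub>t Xs"
  shows "tft (kaczmarz_step A B j X \<ominus>\<^sub>t Xs) k c d =
    tft E k c d - cnj (tft A k j c) * ((\<Sum>b<l. tft A k j b * tft E k b d) / complex_of_real (row_energy k j))"
proof -
  let ?a = "row_slice A j"
  let ?g = "?a \<star>\<^sub>t tadjoint ?a"
  let ?R = "?a \<star>\<^sub>t X \<ominus>\<^sub>t row_slice B j"
  have a: "?a \<in> tensors 1 l n" by (rule row_slice_tensors[OF A])
  have b: "row_slice B j \<in> tensors 1 p n" by (rule row_slice_tensors[OF B])
  note g = tprod_row_gram_tensors[OF A n, of j]
  note I = tinv_scalar[OF g n inv[OF j]]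
  note R = step_residual_tensors[OF X, of j] and F = step_factor_tensors[OF j]
  have aX: "?a \<star>\<^sub>t X \<in> tensors 1 p n" by (rule tprod_tensors[OF a X n])
  have g': "tft (tinv ?g) k 0 0 = 1 / complex_of_real (row_energy k j)"
    using I(2)[of k] row_energy_pos[OF j, of k]
    by (simp add: tft_row_gram[OF A n] flip: row_energy_def) (simp add: field_simps)
  have "tft ?R k 0 d = (\<Sum>b<l. tft A k j b * tft X k b d) - tft B k j d"
    by (simp add: tft_tminus[OF aX b n] tft_tprod[OF a X n] tft_row_slice[OF A n] tft_row_slice[OF B n] d)
  \<comment> \<open>Consistency enters here: row \<open>j\<close> of \<open>B\<close> is row
    \<open>j\<close> of \<open>A\<close> times \<open>Xs\<close>, so the residual depends on the
    error alone.\<close>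
  also have "tft B k j d = (\<Sum>b<l. tft A k j b * tft Xs k b d)"
    unfolding AXs[symmetric] by (rule tft_tprod[OF A Xs n j d])
  finally have R': "tft ?R k 0 d = (\<Sum>b<l. tft A k j b * tft E k b d)"
    using d by (simp add: E_def tft_tminus[OF X Xs n] right_diff_distrib sum_subtractf)
  have F': "tft (tadjoint ?a \<star>\<^sub>t tinv ?g) k c 0 = cnj (tft A k j c) / complex_of_real (row_energy k j)"
    using c by (simp add: tft_tprod[OF tadjoint_tensors[OF a n] I(1) n] g' tft_tadjoint[OF a n] tft_row_slice[OF A n])
  have "tft (kaczmarz_step A B j X \<ominus>\<^sub>t Xs) k c d =
    tft X k c d - tft (tadjoint ?a \<star>\<^sub>t tinv ?g) k c 0 * tft ?R k 0 d - tft Xs k c d"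
    using c d unfolding tft_tminus[OF kaczmarz_step_tensors[OF j X] Xs n c d]
    unfolding kaczmarz_step_def Let_def
    by (simp add: tft_tminus[OF X tprod_tensors[OF F R n] n] tft_tprod[OF F R n])
  then show ?thesis
    using c d by (simp add: R' F' E_def tft_tminus[OF X Xs n])
qed

text \<open>As an abbreviation it keeps the exported bounds in terms of the expression in the
  theorem itself.\<close>

abbreviation (input) "\<rho> \<equiv> Min ((\<lambda>k. (sigma_min (fourier3 A ! k))\<^sup>2
  / (real m * (norm_inf_2 (fourier3 A ! k))\<^sup>2)) ` {..<n})"

lemma slice_bounds:
  assumes "k < n"
  shows "(sigma_min (fourier3 A ! k))\<^sup>2 * (\<Sum>c<l. (cmod (y c))\<^sup>2) \<le> (\<Sum>j<m. (cmod (\<Sum>c<l. tft A k j c * y c))\<^sup>2)"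
    "j < m \<Longrightarrow> row_energy k j \<le> (norm_inf_2 (fourier3 A ! k))\<^sup>2"
    "\<rho> \<le> (sigma_min (fourier3 A ! k))\<^sup>2 / (real m * (norm_inf_2 (fourier3 A ! k))\<^sup>2)"
  using sigma_min_bound[OF fourier3_carrier[OF A assms] l_pos, of y]
    norm_inf_2_row[OF fourier3_carrier[OF A assms], of j] assms
  by (simp_all add: fourier3_index[OF A assms] row_energy_def)

lemma norm_inf_2_pos:
  assumes "k < n"
  shows "0 < (norm_inf_2 (fourier3 A ! k))\<^sup>2"
  using row_energy_pos[OF m, of k] slice_bounds(2)[OF assms m] by linarith

text \<open>Testing the singular value bound with the first unit vector shows that
  \<open>sigma_min\<close> squared is at most \<open>m\<close> times the largest squared row norm in
  slice 0. The contraction factor is thus nonnegative, which the induction over the path length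
  uses.\<close>

lemma rho_le_1: "\<rho> \<le> 1"
proof -
  let ?\<sigma> = "(sigma_min (fourier3 A ! 0))\<^sup>2" and ?\<eta> = "(norm_inf_2 (fourier3 A ! 0))\<^sup>2"
  have "?\<sigma> = ?\<sigma> * (\<Sum>c<l. (cmod (if c = 0 then 1 else 0))\<^sup>2)"
    using l_pos by (simp add: if_distrib[of cmod] if_distrib[of "\<lambda>x. x\<^sup>2"] cong: if_cong)
  also have "\<dots> \<le> (\<Sum>j<m. (cmod (\<Sum>c<l. tft A 0 j c * (if c = 0 then 1 else 0)))\<^sup>2)"
    by (rule slice_bounds(1)[OF n])
  also have "\<dots> = (\<Sum>j<m. (cmod (tft A 0 j 0))\<^sup>2)"
    using l_pos by (simp add: if_distrib[of "(*) _"] cong: if_cong)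
  also have "\<dots> \<le> (\<Sum>j<m. ?\<eta>)"
  proof (intro sum_mono)
    fix j assume "j \<in> {..<m}"
    then have "row_energy 0 j \<le> ?\<eta>" using slice_bounds(2)[OF n] by simp
    moreover have "(cmod (tft A 0 j 0))\<^sup>2 \<le> row_energy 0 j"
      unfolding row_energy_def using l_pos
      by (intro member_le_sum[of 0 "{..<l}" "\<lambda>c. (cmod (tft A 0 j c))\<^sup>2"]) auto
    ultimately show "(cmod (tft A 0 j 0))\<^sup>2 \<le> ?\<eta>" by linarith
  qed
  finally have "?\<sigma> \<le> real m * ?\<eta>" by simp
  then have "?\<sigma> / (real m * ?\<eta>) \<le> 1"
    using m norm_inf_2_pos[OF n] by (simp add: divide_le_eq_1_pos)
  then show ?thesis using slice_bounds(3)[OF n] by linarith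
qed

lemma sum_step_column:
  assumes k: "k < n" and d: "d < p" and X: "X \<in> tensors l p n"
  defines "E \<equiv> X \<ominus>\<^sub>t Xs"
  shows "(\<Sum>j<m. \<Sum>c<l. (cmod (tft (kaczmarz_step A B j X \<ominus>\<^sub>t Xs) k c d))\<^sup>2)
    \<le> real m * (1 - \<rho>) * (\<Sum>c<l. (cmod (tft E k c d))\<^sup>2)"
proof -
  let ?\<sigma> = "(sigma_min (fourier3 A ! k))\<^sup>2" and ?\<eta> = "(norm_inf_2 (fourier3 A ! k))\<^sup>2"
  define s where "s = (\<Sum>c<l. (cmod (tft E k c d))\<^sup>2)"
  define S where "S j = (\<Sum>c<l. tft A k j c * tft E k c d)" for j
  have "0 \<le> s" unfolding s_def by (intro sum_nonneg) auto
  note eta = norm_inf_2_pos[OF k]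
  have "(\<Sum>j<m. \<Sum>c<l. (cmod (tft (kaczmarz_step A B j X \<ominus>\<^sub>t Xs) k c d))\<^sup>2) =
    (\<Sum>j<m. s - (cmod (S j))\<^sup>2 / row_energy k j)"
  proof (intro sum.cong refl)
    fix j assume "j \<in> {..<m}"
    then have j: "j < m" by simp
    have "(\<Sum>c<l. (cmod (tft E k c d - cnj (tft A k j c) * (S j / complex_of_real (row_energy k j))))\<^sup>2) =
      s - (cmod (S j))\<^sup>2 / row_energy k j"
      unfolding s_def using row_energy_pos[OF j, of k]
      by (intro projection_norm) (auto simp: row_energy_def S_def)
    then show "(\<Sum>c<l. (cmod (tft (kaczmarz_step A B j X \<ominus>\<^sub>t Xs) k c d))\<^sup>2) = s - (cmod (S j))\<^sup>2 / row_energy k j"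
      using tft_kaczmarz_step[OF j X _ d, of _ k] by (simp add: E_def S_def)
  qed
  \<comment> \<open>The row energies vary with \<open>j\<close>; a common upper bound allows the
    squared products to be added over the rows.\<close>
  also have "\<dots> \<le> (\<Sum>j<m. s - (cmod (S j))\<^sup>2 / ?\<eta>)"
    using row_energy_pos slice_bounds(2)[OF k]
    by (intro sum_mono diff_left_mono divide_left_mono mult_pos_pos eta) auto
  also have "\<dots> = real m * s - (\<Sum>j<m. (cmod (S j))\<^sup>2) / ?\<eta>"
    by (simp add: sum_subtractf sum_divide_distrib)
  also have "\<dots> \<le> real m * s - ?\<sigma> * s / ?\<eta>"
    using slice_bounds(1)[OF k, of "\<lambda>c. tft E k c d"] eta
    by (intro diff_left_mono divide_right_mono) (auto simp: s_def S_def)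
  also have "\<dots> = real m * (1 - ?\<sigma> / (real m * ?\<eta>)) * s"
    using m by (simp add: field_simps)
  \<comment> \<open>The factor of slice \<open>k\<close> is weakened to one valid for all slices, so
    that slices and columns can be summed.\<close>
  also have "\<dots> \<le> real m * (1 - \<rho>) * s"
    using slice_bounds(3)[OF k] \<open>0 \<le> s\<close> by (intro mult_right_mono mult_left_mono) auto
  finally show ?thesis by (simp add: s_def)
qed

lemma sum_step_error:
  assumes X: "X \<in> tensors l p n"
  shows "(\<Sum>j<m. (frob_norm (kaczmarz_step A B j X \<ominus>\<^sub>t Xs))\<^sup>2) \<le> real m * (1 - \<rho>) * (frob_norm (X \<ominus>\<^sub>t Xs))\<^sup>2"
proof -
  have fro: "(frob_norm Y)\<^sup>2 = (\<Sum>k<n. \<Sum>d<p. \<Sum>c<l. (cmod (tft Y k c d))\<^sup>2) / real n" if "Y \<in> tensors l p n" for Y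
    unfolding frob_norm_tft[OF that n]
    by (rule arg_cong[where f = "\<lambda>x. x / real n"]) (intro sum.cong refl sum.swap)
  have XE: "X \<ominus>\<^sub>t Xs \<in> tensors l p n" using X Xs by simp
  have YE: "kaczmarz_step A B j X \<ominus>\<^sub>t Xs \<in> tensors l p n" if "j < m" for j
    using kaczmarz_step_tensors[OF that X] Xs by simp
  let ?e = "\<lambda>j k d. \<Sum>c<l. (cmod (tft (kaczmarz_step A B j X \<ominus>\<^sub>t Xs) k c d))\<^sup>2"
  have "(\<Sum>j<m. \<Sum>k<n. \<Sum>d<p. ?e j k d) = (\<Sum>k<n. \<Sum>j<m. \<Sum>d<p. ?e j k d)"
    by (rule sum.swap)
  also have "\<dots> = (\<Sum>k<n. \<Sum>d<p. \<Sum>j<m. ?e j k d)"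
    by (intro sum.cong refl sum.swap)
  also have "\<dots> \<le> (\<Sum>k<n. \<Sum>d<p. real m * (1 - \<rho>) * (\<Sum>c<l. (cmod (tft (X \<ominus>\<^sub>t Xs) k c d))\<^sup>2))"
    by (intro sum_mono sum_step_column X) auto
  also have "\<dots> = real m * (1 - \<rho>) * (\<Sum>k<n. \<Sum>d<p. \<Sum>c<l. (cmod (tft (X \<ominus>\<^sub>t Xs) k c d))\<^sup>2)"
    by (simp only: sum_distrib_left)
  finally have "(\<Sum>j<m. \<Sum>k<n. \<Sum>d<p. ?e j k d) / real n
    \<le> real m * (1 - \<rho>) * (\<Sum>k<n. \<Sum>d<p. \<Sum>c<l. (cmod (tft (X \<ominus>\<^sub>t Xs) k c d))\<^sup>2) / real n"
    by (rule divide_right_mono) simp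
  moreover have "(\<Sum>j<m. (frob_norm (kaczmarz_step A B j X \<ominus>\<^sub>t Xs))\<^sup>2) = (\<Sum>j<m. \<Sum>k<n. \<Sum>d<p. ?e j k d) / real n"
    by (simp add: fro YE sum_divide_distrib)
  ultimately show ?thesis by (simp only: fro[OF XE] times_divide_eq_right)
qed

text \<open>Induction on the length with the last index split off: for a fixed prefix, the sum over
  the last row is the one-step bound at the iterate reached by that prefix.\<close>

lemma sum_path_error:
  assumes X: "X \<in> tensors l p n"
  shows "(\<Sum>i\<in>PiE {..<t} (\<lambda>_. {..<m}). (frob_norm (kaczmarz A B X i t \<ominus>\<^sub>t Xs))\<^sup>2)
    \<le> (real m * (1 - \<rho>)) ^ t * (frob_norm (X \<ominus>\<^sub>t Xs))\<^sup>2"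
proof (induction t)
  case 0
  then show ?case by simp
next
  case (Suc t)
  let ?P = "PiE {..<t} (\<lambda>_. {..<m})" and ?q = "real m * (1 - \<rho>)"
  let ?f = "\<lambda>i t. (frob_norm (kaczmarz A B X i t \<ominus>\<^sub>t Xs))\<^sup>2"
  have "(\<Sum>i\<in>PiE {..<Suc t} (\<lambda>_. {..<m}). ?f i (Suc t)) = (\<Sum>(j, g)\<in>{..<m} \<times> ?P. ?f (g(t := j)) (Suc t))"
    unfolding lessThan_Suc PiE_insert_eq
    by (subst sum.reindex[OF inj_combinator]) (auto simp: case_prod_unfold)
  also have "\<dots> = (\<Sum>(j, g)\<in>{..<m} \<times> ?P. (frob_norm (kaczmarz_step A B j (kaczmarz A B X g t) \<ominus>\<^sub>t Xs))\<^sup>2)"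
  proof (intro sum.cong refl, clarify)
    fix j g
    have "kaczmarz A B X (g(t := j)) t = kaczmarz A B X g t" by (rule kaczmarz_cong) simp
    then show "?f (g(t := j)) (Suc t) = (frob_norm (kaczmarz_step A B j (kaczmarz A B X g t) \<ominus>\<^sub>t Xs))\<^sup>2"
      by (simp only: kaczmarz_Suc fun_upd_same)
  qed
  also have "\<dots> = (\<Sum>g\<in>?P. \<Sum>j<m. (frob_norm (kaczmarz_step A B j (kaczmarz A B X g t) \<ominus>\<^sub>t Xs))\<^sup>2)"
    unfolding sum.cartesian_product[symmetric] by (rule sum.swap)
  also have "\<dots> \<le> (\<Sum>g\<in>?P. ?q * ?f g t)"
    by (intro sum_mono sum_step_error kaczmarz_tensors X) auto
  also have "\<dots> = ?q * (\<Sum>g\<in>?P. ?f g t)" by (rule sum_distrib_left[symmetric])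
  also have "\<dots> \<le> ?q * (?q ^ t * (frob_norm (X \<ominus>\<^sub>t Xs))\<^sup>2)"
    using Suc.IH rho_le_1 by (intro mult_left_mono) auto
  finally show ?case by (simp only: power_Suc mult.assoc)
qed

end

section \<open>Conditional expectation over the index paths\<close>

lemma space_tensor_borel [simp]: "space (tensor_borel l p n) = tensors l p n"
  by (simp add: tensor_borel_def)

lemma measurable_tensor_entry:
  assumes "q < n" "c < l" "d < p"
  shows "(\<lambda>X. X ! q $$ (c, d)) \<in> borel_measurable (tensor_borel l p n)"
proof -
  let ?I = "{..<l} \<times> {..<p} \<times> {..<n}"
  let ?N = "PiM ?I (\<lambda>_. borel :: complex measure)"
  let ?r = "\<lambda>M :: tensor. restrict (\<lambda>(i, j, k). M ! k $$ (i, j)) ?I"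
  have "?r \<in> tensor_borel l p n \<rightarrow>\<^sub>M ?N"
    unfolding tensor_borel_def
    by (intro measurable_vimage_algebra1) (auto simp: space_PiM)
  moreover have "(\<lambda>f. f (c, d, q)) \<in> ?N \<rightarrow>\<^sub>M borel"
    using assms by (intro measurable_component_singleton) auto
  ultimately have "(\<lambda>X. ?r X (c, d, q)) \<in> borel_measurable (tensor_borel l p n)"
    by (rule measurable_compose)
  then show ?thesis using assms by simp
qed

section \<open>Measurability of the iterate in the starting tensor\<close>

text \<open>Stated entry by entry because the entry formulas of differences and t-products propagate
  it directly; the dimension clause makes those formulas applicable.\<close>

definition tensor_measurable :: "'a measure \<Rightarrow> ('a \<Rightarrow> tensor) \<Rightarrow> nat \<Rightarrow> nat \<Rightarrow> nat \<Rightarrow> bool" where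
  "tensor_measurable M T l p n \<longleftrightarrow> (\<forall>x\<in>space M. T x \<in> tensors l p n) \<and>
    (\<forall>q<n. \<forall>c<l. \<forall>d<p. (\<lambda>x. T x ! q $$ (c, d)) \<in> borel_measurable M)"

lemma tensor_measurable_const:
  "T \<in> tensors l p n \<Longrightarrow> tensor_measurable M (\<lambda>_. T) l p n"
  by (simp add: tensor_measurable_def)

lemma tensor_measurable_id:
  "tensor_measurable (tensor_borel l p n) (\<lambda>X. X) l p n"
  by (simp add: tensor_measurable_def measurable_tensor_entry)

lemma tensor_measurable_tminus:
  assumes S: "tensor_measurable M S l p n" and T: "tensor_measurable M T l p n"
  shows "tensor_measurable M (\<lambda>x. S x \<ominus>\<^sub>t T x) l p n"
  unfolding tensor_measurable_def
proof (intro conjI ballI allI impI)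
  fix q c d assume lt: "q < n" "c < l" "d < p"
  have "(\<lambda>x. S x ! q $$ (c, d) - T x ! q $$ (c, d)) \<in> borel_measurable M"
    using S T lt by (intro borel_measurable_diff) (auto simp: tensor_measurable_def)
  moreover have "(S x \<ominus>\<^sub>t T x) ! q $$ (c, d) = S x ! q $$ (c, d) - T x ! q $$ (c, d)"
    if "x \<in> space M" for x
    using S T lt that by (intro tminus_index) (auto simp: tensor_measurable_def)
  ultimately show "(\<lambda>x. (S x \<ominus>\<^sub>t T x) ! q $$ (c, d)) \<in> borel_measurable M"
    by (simp cong: measurable_cong)
qed (use S T in \<open>auto simp: tensor_measurable_def\<close>)

lemma tensor_measurable_tprod:
  assumes S: "tensor_measurable M S m l n" and T: "tensor_measurable M T l p n" and n: "0 < n"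
  shows "tensor_measurable M (\<lambda>x. S x \<star>\<^sub>t T x) m p n"
  unfolding tensor_measurable_def
proof (intro conjI ballI allI impI)
  fix q c d assume lt: "q < n" "c < m" "d < p"
  have "(\<lambda>x. \<Sum>s<n. \<Sum>b<l. S x ! ((q + n - s) mod n) $$ (c, b) * T x ! s $$ (b, d)) \<in> borel_measurable M"
    using S T lt n by (intro borel_measurable_sum borel_measurable_times) (auto simp: tensor_measurable_def)
  moreover have "(S x \<star>\<^sub>t T x) ! q $$ (c, d) =
    (\<Sum>s<n. \<Sum>b<l. S x ! ((q + n - s) mod n) $$ (c, b) * T x ! s $$ (b, d))"
    if "x \<in> space M" for x
    using S T lt that by (intro tprod_index) (auto simp: tensor_measurable_def)
  ultimately show "(\<lambda>x. (S x \<star>\<^sub>t T x) ! q $$ (c, d)) \<in> borel_measurable M"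
    by (simp cong: measurable_cong)
qed (use S T n in \<open>auto simp: tensor_measurable_def intro: tprod_tensors\<close>)

lemma borel_measurable_frob_norm:
  assumes T: "tensor_measurable M T l p n" and n: "0 < n"
  shows "(\<lambda>x. frob_norm (T x)) \<in> borel_measurable M"
proof -
  have "(\<lambda>x. sqrt (\<Sum>k<n. \<Sum>i<l. \<Sum>j<p. (cmod (T x ! k $$ (i, j)))\<^sup>2)) \<in> borel_measurable M"
    using T by (intro measurable_compose[OF _ borel_measurable_sqrt] borel_measurable_sum borel_measurable_power
        measurable_compose[OF _ borel_measurable_norm]) (auto simp: tensor_measurable_def)
  moreover have "frob_norm (T x) = sqrt (\<Sum>k<n. \<Sum>i<l. \<Sum>j<p. (cmod (T x ! k $$ (i, j)))\<^sup>2)"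
    if "x \<in> space M" for x
  proof -
    have "T x \<in> tensors l p n" using T that by (simp add: tensor_measurable_def)
    from tensorsD[OF this n] show ?thesis by (simp add: frob_norm_def)
  qed
  ultimately show ?thesis by (simp cong: measurable_cong)
qed

text \<open>For a fixed index path each step is affine in the iterate with constant coefficients.
  The tensor inverse is one of these constants, so no measurability of inversion arises.\<close>

lemma tensor_measurable_kaczmarz:
  assumes "0 < n" and A: "A \<in> tensors m l n"
    and inv: "\<And>j. j < m \<Longrightarrow> tinvertible (row_slice A j \<star>\<^sub>t tadjoint (row_slice A j))"
    and B: "B \<in> tensors m p n" and "\<And>s. s < t \<Longrightarrow> i s < m"
  shows "tensor_measurable (tensor_borel l p n) (\<lambda>X. kaczmarz A B X i t) l p n"
  using assms(5)
proof (induction t)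
  case 0
  then show ?case by (simp add: tensor_measurable_id)
next
  case (Suc t)
  let ?a = "row_slice A (i t)"
  have a: "?a \<in> tensors 1 l n" and b: "row_slice B (i t) \<in> tensors 1 p n"
    by (rule row_slice_tensors[OF A] row_slice_tensors[OF B])+
  have "tinv (?a \<star>\<^sub>t tadjoint ?a) \<in> tensors 1 1 n"
    using Suc.prems by (intro tinv_scalar(1)[OF tprod_row_gram_tensors[OF A \<open>0 < n\<close>] \<open>0 < n\<close>] inv) simp
  then have f: "tadjoint ?a \<star>\<^sub>t tinv (?a \<star>\<^sub>t tadjoint ?a) \<in> tensors l 1 n"
    by (rule tprod_tensors[OF tadjoint_tensors[OF a \<open>0 < n\<close>] _ \<open>0 < n\<close>])
  have IH: "tensor_measurable (tensor_borel l p n) (\<lambda>X. kaczmarz A B X i t) l p n"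
    using Suc by simp
  show ?case
    unfolding kaczmarz.simps(2) Let_def
    by (rule tensor_measurable_tminus[OF IH]
        tensor_measurable_tprod[OF tensor_measurable_const[OF f] _ \<open>0 < n\<close>]
        tensor_measurable_tminus[OF _ tensor_measurable_const[OF b]]
        tensor_measurable_tprod[OF tensor_measurable_const[OF a] IH \<open>0 < n\<close>])+
qed

section \<open>Independence and conditional expectation\<close>

lemma (in prob_space) finite_measure_subalgebra_sigma_gen:
  assumes "X \<in> M \<rightarrow>\<^sub>M N"
  shows "finite_measure_subalgebra M (sigma_gen M X N)"
proof
  show "subalgebra M (sigma_gen M X N)"
    using assms measurable_space[OF assms] by (auto simp: subalgebra_def sigma_gen_def sets_vimage_algebra2)
qed

lemma measurable_sigma_gen:
  assumes "X \<in> space M \<rightarrow> space N"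
  shows "X \<in> sigma_gen M X N \<rightarrow>\<^sub>M N"
  unfolding sigma_gen_def using assms by (rule measurable_vimage_algebra1)

text \<open>By independence the conditional probability of \<open>E\<close> given \<open>F\<close>
  is the constant \<open>prob E\<close>; integrating an \<open>F\<close>-measurable \<open>f\<close>
  against it factors the integral.\<close>

lemma (in prob_space) nn_integral_indep_event:
  assumes F: "finite_measure_subalgebra M F"
    and E: "E \<in> events" and indep: "\<And>C. C \<in> sets F \<Longrightarrow> prob (C \<inter> E) = prob C * prob E"
    and f: "f \<in> borel_measurable F"
  shows "(\<integral>\<^sup>+x. f x * indicator E x \<partial>M) = ennreal (prob E) * (\<integral>\<^sup>+x. f x \<partial>M)"
proof -
  interpret F: finite_measure_subalgebra M F by (rule F)
  have sub: "C \<in> events" if "C \<in> sets F" for C using F.subalg that by (auto simp: subalgebra_def)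
  have f': "f \<in> borel_measurable M" by (rule measurable_from_subalg[OF F.subalg f])
  have "AE x in M. ennreal (prob E) = nn_cond_exp M F (indicator E) x"
  proof (rule F.nn_cond_exp_charact)
    fix C assume C: "C \<in> sets F"
    have "(\<integral>\<^sup>+x\<in>C. indicator E x \<partial>M) = emeasure M (C \<inter> E)"
      using sub[OF C] E by (simp add: indicator_inter_arith[symmetric] mult.commute[of "indicator E _"] Int_commute)
    also have "\<dots> = ennreal (prob E) * emeasure M C"
      by (simp add: emeasure_eq_measure indep[OF C] ennreal_mult mult.commute)
    also have "\<dots> = (\<integral>\<^sup>+x\<in>C. ennreal (prob E) \<partial>M)"
      using sub[OF C] by (simp add: nn_integral_cmult_indicator)
    finally show "(\<integral>\<^sup>+x\<in>C. indicator E x \<partial>M) = (\<integral>\<^sup>+x\<in>C. ennreal (prob E) \<partial>M)" .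
  qed (use E in auto)
  then have "(\<integral>\<^sup>+x. f x * nn_cond_exp M F (indicator E) x \<partial>M) = (\<integral>\<^sup>+x. f x * ennreal (prob E) \<partial>M)"
    by (intro nn_integral_cong_AE) auto
  then show ?thesis
    using f' E F.nn_cond_exp_intg[OF f, of "indicator E"]
    by (simp add: nn_integral_multc mult.commute)
qed

text \<open>Conditioning keeps the \<open>F\<close>-measurable weights \<open>h j\<close> and
  replaces each indicator by its probability. Values in \<open>ennreal\<close> avoid integrability
  conditions.\<close>

lemma (in prob_space) nn_cond_exp_indep_sum:
  assumes F: "finite_measure_subalgebra M F" and "finite J"
    and E: "\<And>j. j \<in> J \<Longrightarrow> E j \<in> events"
    and indep: "\<And>j C. j \<in> J \<Longrightarrow> C \<in> sets F \<Longrightarrow> prob (C \<inter> E j) = prob C * prob (E j)"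
    and h: "\<And>j. j \<in> J \<Longrightarrow> h j \<in> borel_measurable F"
    and f: "\<And>x. x \<in> space M \<Longrightarrow> f x = (\<Sum>j\<in>J. h j x * indicator (E j) x)"
  shows "AE x in M. (\<Sum>j\<in>J. ennreal (prob (E j)) * h j x) = nn_cond_exp M F f x"
proof -
  interpret F: finite_measure_subalgebra M F by (rule F)
  have h': "h j \<in> borel_measurable M" if "j \<in> J" for j
    by (rule measurable_from_subalg[OF F.subalg h[OF that]])
  show ?thesis
  proof (rule F.nn_cond_exp_charact)
    fix C assume C: "C \<in> sets F"
    have C': "C \<in> events" using F.subalg C by (auto simp: subalgebra_def)
    have "(\<integral>\<^sup>+x\<in>C. f x \<partial>M) = (\<integral>\<^sup>+x. (\<Sum>j\<in>J. (h j x * indicator C x) * indicator (E j) x) \<partial>M)"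
      by (intro nn_integral_cong) (simp add: f sum_distrib_left mult_ac)
    also have "\<dots> = (\<Sum>j\<in>J. \<integral>\<^sup>+x. (h j x * indicator C x) * indicator (E j) x \<partial>M)"
      using h' E C' by (intro nn_integral_sum) auto
    also have "\<dots> = (\<Sum>j\<in>J. ennreal (prob (E j)) * (\<integral>\<^sup>+x. h j x * indicator C x \<partial>M))"
      using h C by (intro sum.cong refl nn_integral_indep_event[OF F E indep]) auto
    also have "\<dots> = (\<Sum>j\<in>J. \<integral>\<^sup>+x. ennreal (prob (E j)) * (h j x * indicator C x) \<partial>M)"
      using h' C' by (intro sum.cong refl nn_integral_cmult[symmetric]) auto
    also have "\<dots> = (\<integral>\<^sup>+x. (\<Sum>j\<in>J. ennreal (prob (E j)) * (h j x * indicator C x)) \<partial>M)"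
      using h' C' by (intro nn_integral_sum[symmetric]) auto
    also have "\<dots> = (\<integral>\<^sup>+x\<in>C. (\<Sum>j\<in>J. ennreal (prob (E j)) * h j x) \<partial>M)"
      by (simp add: sum_distrib_right mult.assoc)
    finally show "(\<integral>\<^sup>+x\<in>C. f x \<partial>M) = (\<integral>\<^sup>+x\<in>C. (\<Sum>j\<in>J. ennreal (prob (E j)) * h j x) \<partial>M)" .
  next
    have "(\<lambda>x. \<Sum>j\<in>J. h j x * indicator (E j) x) \<in> borel_measurable M"
      using h' E by (intro borel_measurable_sum borel_measurable_times_ennreal borel_measurable_indicator) auto
    then show "f \<in> borel_measurable M" using f by (simp cong: measurable_cong)
    show "(\<lambda>x. \<Sum>j\<in>J. ennreal (prob (E j)) * h j x) \<in> borel_measurable F"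
      using h by (intro borel_measurable_sum borel_measurable_times_ennreal) auto
  qed
qed

lemma (in prob_space) prob_iid_uniform_path:
  fixes i :: "nat \<Rightarrow> 'a \<Rightarrow> nat"
  assumes m: "0 < m"
    and iid: "indep_vars (\<lambda>_. count_space {..<m}) i UNIV"
    and unif: "\<And>s. distr M (count_space {..<m}) (i s) = uniform_count_measure {..<m}"
    and g: "g \<in> PiE {..<T} (\<lambda>_. {..<m})"
  shows "prob {w \<in> space M. \<forall>s<T. i s w = g s} = (1 / real m) ^ T"
proof (cases "T = 0")
  \<comment> \<open>With no \<open>s\<close> the intersection used in the other case would be
    \<open>UNIV\<close> instead of the sample space.\<close>
  case True
  then show ?thesis by (simp add: prob_space)
next
  case False
  have rv: "i s \<in> M \<rightarrow>\<^sub>M count_space {..<m}" for s using iid by (simp add: indep_vars_def)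
  have gm: "g s < m" if "s < T" for s using PiE_mem[OF g, of s] that by simp
  have one: "prob (i s -` {g s} \<inter> space M) = 1 / real m" if "s < T" for s
  proof -
    have "prob (i s -` {g s} \<inter> space M) = measure (distr M (count_space {..<m}) (i s)) {g s}"
      using gm[OF that] by (intro measure_distr[symmetric] rv) auto
    also have "\<dots> = 1 / real m"
      unfolding unif using gm[OF that] by (subst measure_uniform_count_measure) auto
    finally show ?thesis .
  qed
  have "{w \<in> space M. \<forall>s<T. i s w = g s} = (\<Inter>s\<in>{..<T}. i s -` {g s} \<inter> space M)"
    using False by auto
  also have "prob \<dots> = (\<Prod>s<T. prob (i s -` {g s} \<inter> space M))"
    using False gm by (intro indep_varsD[OF iid]) auto
  also have "\<dots> = (1 / real m) ^ T" by (simp add: one)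
  finally show ?thesis .
qed

theorem theorem11:
  fixes m l n p :: nat
    and A B Xs :: tensor
    and P :: "'w measure"
    and i :: "nat \<Rightarrow> 'w \<Rightarrow> nat"
    and X0 :: "'w \<Rightarrow> tensor"
    and t :: nat
  assumes "0 < m" and "0 < n"
    and "A \<in> tensors m l n"
    and "\<And>j. j < m \<Longrightarrow> tinvertible (row_slice A j \<star>\<^sub>t tadjoint (row_slice A j))"
    and "B \<in> tensors m p n"
    and "Xs \<in> tensors l p n"
    and "A \<star>\<^sub>t Xs = B"
    and "prob_space P"
    and "prob_space.indep_vars P (\<lambda>_. count_space {..<m}) i UNIV"
    and "\<And>s. distr P (count_space {..<m}) (i s) = uniform_count_measure {..<m}"
    and "X0 \<in> P \<rightarrow>\<^sub>M tensor_borel l p n"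
    and "prob_space.indep_set P
           (sets (sigma_gen P X0 (tensor_borel l p n)))
           (sets (sigma_gen P (\<lambda>w s. i s w) (PiM UNIV (\<lambda>_. count_space {..<m}))))"
  shows "AE w in P.
    nn_cond_exp P (sigma_gen P X0 (tensor_borel l p n))
      (\<lambda>w. ennreal ((frob_norm (kaczmarz A B (X0 w) (\<lambda>s. i s w) (Suc t) \<ominus>\<^sub>t Xs))\<^sup>2)) w
    \<le> ennreal ((1 - Min ((\<lambda>k. (sigma_min (fourier3 A ! k))\<^sup>2
                              / (real m * (norm_inf_2 (fourier3 A ! k))\<^sup>2)) ` {..<n})) ^ (t + 1)
               * (frob_norm (X0 w \<ominus>\<^sub>t Xs))\<^sup>2)"
proof -
  interpret prob_space P by fact
  let ?N = "tensor_borel l p n" and ?I = "PiM UNIV (\<lambda>_ :: nat. count_space {..<m})"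
  let ?F = "sigma_gen P X0 ?N" and ?G = "sigma_gen P (\<lambda>w s. i s w) ?I"
  let ?f = "\<lambda>w. ennreal ((frob_norm (kaczmarz A B (X0 w) (\<lambda>s. i s w) (Suc t) \<ominus>\<^sub>t Xs))\<^sup>2)"
  let ?q = "1 - Min ((\<lambda>k. (sigma_min (fourier3 A ! k))\<^sup>2
      / (real m * (norm_inf_2 (fourier3 A ! k))\<^sup>2)) ` {..<n})"
  \<comment> \<open>\<open>t + 1\<close> steps read the indices at positions \<open>0\<close> to
    \<open>t\<close>, so prefixes of this length determine the iterate for a given start.\<close>
  define J where "J = PiE {..<Suc t} (\<lambda>_. {..<m})"
  define E where "E g = {w \<in> space P. \<forall>s<Suc t. i s w = g s}" for g
  define e where "e g X = (frob_norm (kaczmarz A B X g (Suc t) \<ominus>\<^sub>t Xs))\<^sup>2" for g X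
  have J: "finite J" unfolding J_def by (intro finite_PiE) auto
  have F: "finite_measure_subalgebra P ?F" by (rule finite_measure_subalgebra_sigma_gen) fact
  have X0: "X0 \<in> space P \<rightarrow> tensors l p n" using measurable_space[OF assms(11)] by auto
  have rv: "i s \<in> P \<rightarrow>\<^sub>M count_space {..<m}" for s using assms(9) by (simp add: indep_vars_def)
  have im: "i s w < m" if "w \<in> space P" for s w using measurable_space[OF rv that, of s] by simp
  \<comment> \<open>A prefix event is a cylinder in sequence space, so it lies in the sigma-algebra
    generated by the whole index sequence, the one assumed independent of \<open>X0\<close>.\<close>
  have EG: "E g \<in> sets ?G" if "g \<in> J" for g
  proof -
    let ?S = "{\<omega> \<in> space ?I. \<forall>s\<in>{..<Suc t}. \<omega> s = g s}"
    have "?S \<in> sets ?I"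
    proof (rule sets.sets_Collect_finite_All)
      fix s assume "s \<in> {..<Suc t}"
      have c: "(\<lambda>\<omega>. \<omega> s) \<in> ?I \<rightarrow>\<^sub>M count_space {..<m}" by (rule measurable_component_singleton) simp
      have "g s \<in> {..<m}" using that \<open>s \<in> {..<Suc t}\<close> by (auto simp: J_def PiE_iff)
      then have "(\<lambda>\<omega>. \<omega> s) -` {g s} \<inter> space ?I \<in> sets ?I" by (intro measurable_sets[OF c]) simp
      then show "{\<omega> \<in> space ?I. \<omega> s = g s} \<in> sets ?I" by (simp add: vimage_def Int_def conj_commute)
    qed simp
    then have "(\<lambda>w s. i s w) -` ?S \<inter> space P \<in> sets ?G"
      unfolding sigma_gen_def by (rule in_vimage_algebra)
    also have "(\<lambda>w s. i s w) -` ?S \<inter> space P = E g"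
      using im by (auto simp: E_def space_PiM)
    finally show ?thesis .
  qed
  have Eprob: "prob (E g) = (1 / real m) ^ Suc t" if "g \<in> J" for g
    unfolding E_def by (rule prob_iid_uniform_path[OF assms(1,9,10) that[unfolded J_def]])
  have ind: "indep_set (sets ?F) (sets ?G)" by fact
  have emeas: "(\<lambda>w. ennreal (e g (X0 w))) \<in> borel_measurable ?F" if "g \<in> J" for g
  proof -
    have "g s < m" if "s < Suc t" for s using \<open>g \<in> J\<close> that by (auto simp: J_def PiE_iff)
    then have "tensor_measurable ?N (\<lambda>X. kaczmarz A B X g (Suc t) \<ominus>\<^sub>t Xs) l p n"
      by (intro tensor_measurable_tminus tensor_measurable_kaczmarz[OF assms(2,3,4,5)]
          tensor_measurable_const assms(6)) auto
    then have "(\<lambda>X. ennreal (e g X)) \<in> borel_measurable ?N"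
      unfolding e_def by (intro measurable_compose[OF _ measurable_ennreal] borel_measurable_power
          borel_measurable_frob_norm[OF _ \<open>0 < n\<close>])
    then show ?thesis
      using X0 by (intro measurable_compose[OF measurable_sigma_gen]) auto
  qed
  have paths: "?f w = (\<Sum>g\<in>J. ennreal (e g (X0 w)) * indicator (E g) w)" if w: "w \<in> space P" for w
  proof -
    \<comment> \<open>The observed prefix, in the extensional form that membership in
      \<open>J\<close> demands; it is the only path whose indicator is 1 at
      \<open>w\<close>.\<close>
    define h where "h = restrict (\<lambda>s. i s w) {..<Suc t}"
    have hJ: "h \<in> J" using im[OF w] by (auto simp: h_def J_def)
    have "w \<in> E g \<longleftrightarrow> g = h" if "g \<in> J" for g
    proof
      assume "w \<in> E g"
      then show "g = h" using that hJ unfolding J_def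
        by (intro PiE_ext[of g "{..<Suc t}" _ h]) (auto simp: E_def h_def)
    qed (use w in \<open>auto simp: E_def h_def\<close>)
    then have "(\<Sum>g\<in>J. ennreal (e g (X0 w)) * indicator (E g) w) = (\<Sum>g\<in>J. if g = h then ennreal (e g (X0 w)) else 0)"
      by (intro sum.cong refl) (auto simp: indicator_def)
    also have "\<dots> = ennreal (e h (X0 w))" using J hJ by simp
    also have "e h (X0 w) = (frob_norm (kaczmarz A B (X0 w) (\<lambda>s. i s w) (Suc t) \<ominus>\<^sub>t Xs))\<^sup>2"
      unfolding e_def by (subst kaczmarz_cong[of "Suc t" h "\<lambda>s. i s w"]) (auto simp: h_def)
    finally show ?thesis ..
  qed
  \<comment> \<open>Along a fixed path the squared error is a function of \<open>X0\<close> alone,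
    while the path event is independent of \<open>X0\<close>.\<close>
  have cond: "AE w in P. (\<Sum>g\<in>J. ennreal (prob (E g)) * ennreal (e g (X0 w))) = nn_cond_exp P ?F ?f w"
    using indep_setD[OF ind] EG indep_setD_ev2[OF ind] emeas paths
    by (intro nn_cond_exp_indep_sum[OF F J]) auto
  have bound: "(\<Sum>g\<in>J. ennreal (prob (E g)) * ennreal (e g (X0 w)))
      \<le> ennreal (?q ^ (t + 1) * (frob_norm (X0 w \<ominus>\<^sub>t Xs))\<^sup>2)" if "w \<in> space P" for w
  proof -
    have X: "X0 w \<in> tensors l p n" using X0 that by auto
    have "(\<Sum>g\<in>J. ennreal (prob (E g)) * ennreal (e g (X0 w))) =
      (\<Sum>g\<in>J. ennreal ((1 / real m) ^ Suc t * e g (X0 w)))"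
      by (intro sum.cong refl) (simp only: Eprob, simp add: e_def flip: ennreal_mult)
    also have "\<dots> = ennreal ((1 / real m) ^ Suc t * (\<Sum>g\<in>J. e g (X0 w)))"
      unfolding sum_distrib_left by (intro sum_ennreal) (auto simp: e_def)
    also have "\<dots> \<le> ennreal ((1 / real m) ^ Suc t * ((real m * ?q) ^ Suc t * (frob_norm (X0 w \<ominus>\<^sub>t Xs))\<^sup>2))"
      unfolding J_def e_def
      by (intro ennreal_leI mult_left_mono sum_path_error[OF assms(1-7) X]) auto
    also have "(1 / real m) ^ Suc t * ((real m * ?q) ^ Suc t * (frob_norm (X0 w \<ominus>\<^sub>t Xs))\<^sup>2) =
      ((1 / real m) * (real m * ?q)) ^ Suc t * (frob_norm (X0 w \<ominus>\<^sub>t Xs))\<^sup>2"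
      by (simp only: power_mult_distrib mult.assoc)
    also have "(1 / real m) * (real m * ?q) = ?q" using \<open>0 < m\<close> by simp
    finally show ?thesis by (simp only: Suc_eq_plus1)
  qed
  from cond AE_space show ?thesis
  proof eventually_elim
    case (elim w)
    then show ?case using bound[OF elim(2)] by (simp only: elim(1))
  qed
qed

end
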